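(* Let $G=\mathbb Q^{(\omega)}=\bigoplus_{i\in\mathbb N}G_i$, where each $G_i$ is an isomorphic copy of $\mathbb Q$, and let $\mathcal P$ be the collection of all finite (possibly empty) subsets of $\mathbb N$. For $I\in\mathcal P$ let $H_I$ be the subgroup of $G$ consisting of the elements which are $0$ in every coordinate outside $I$. Then the structure $\mathcal G=(G,+,(H_I)_{I\in\mathcal P})$ is $\omega$-stable of Morley rank $\omega$ and does not have finite dp-rank.
   Context: The language of $\mathcal G$ is the language of abelian groups together with a unary predicate for each subgroup $H_I$. An inp-pattern of depth $\kappa$ for a partial type $\pi(x)$ is a sequence of formulas $(\varphi^\alpha(x,y^\alpha))_{\alpha<\kappa}$ together with natural numbers $(k^\alpha)_{\alpha<\kappa}$ such that there is an array of tuples $(b_i^\alpha)_{\alpha<\kappa,i<\omega}$ in a sufficiently saturated model for which each row $\{\varphi^\alpha(x,b_i^\alpha)\}_{i<\omega}$ is $k^\alpha$-inconsistent, while for every $\eta:\kappa\to\omega$ the path $\pi(x)\cup\{\varphi^\alpha(x,b^\alpha_{\eta(\alpha)})\}_{\alpha<\kappa}$ is consistent. In a stable theory the dp-rank of $\pi$ is the supremum of the cardinals $\kappa$ for which there is an inp-pattern of depth $\kappa$ for $\pi$. The dp-rank of a stable structure is the dp-rank of $\{x=x\}$ ($x$ a single variable). *)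

theory Defs
  imports
    Complex_Main
    "HOL-Library.Poly_Mapping"
    "HOL-Library.FSet"
    "HOL-Library.Extended_Nat"
    "HOL-Library.Countable_Set"
begin

datatype trm = Var nat | Zero | Plus trm trm | Minus trm

text \<open>\<open>Mem I t\<close> is the atomic formula saying that \<open>t\<close> lies in the predicate with index \<open>I\<close>.\<close>

datatype 'i fm =
    Eq trm trm
  | Mem 'i trm
  | Neg "'i fm"
  | Conj "'i fm" "'i fm"
  | Exi nat "'i fm"

primrec fvt :: "trm \<Rightarrow> nat set" where
  "fvt (Var i) = {i}"
| "fvt Zero = {}"
| "fvt (Plus s t) = fvt s \<union> fvt t"
| "fvt (Minus t) = fvt t"

primrec fv :: "'i fm \<Rightarrow> nat set" where
  "fv (Eq s t) = fvt s \<union> fvt t"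
| "fv (Mem I t) = fvt t"
| "fv (Neg \<phi>) = fv \<phi>"
| "fv (Conj \<phi> \<psi>) = fv \<phi> \<union> fv \<psi>"
| "fv (Exi i \<phi>) = fv \<phi> - {i}"

text \<open>
  A structure for this language; the universe is the whole type \<open>'a\<close>, so "all structures" is
  expressed by leaving \<open>'a\<close> a type variable.  No group axioms are imposed: they are part of the
  theory of the structure under consideration.
\<close>

record ('i, 'a) lstructure =
  zero_of :: 'a
  plus_of :: "'a \<Rightarrow> 'a \<Rightarrow> 'a"
  minus_of :: "'a \<Rightarrow> 'a"
  pred_of :: "'i \<Rightarrow> 'a set"

primrec eval_trm :: "('i, 'a) lstructure \<Rightarrow> (nat \<Rightarrow> 'a) \<Rightarrow> trm \<Rightarrow> 'a" where
  "eval_trm M e (Var i) = e i"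
| "eval_trm M e Zero = zero_of M"
| "eval_trm M e (Plus s t) = plus_of M (eval_trm M e s) (eval_trm M e t)"
| "eval_trm M e (Minus t) = minus_of M (eval_trm M e t)"

primrec sat :: "('i, 'a) lstructure \<Rightarrow> (nat \<Rightarrow> 'a) \<Rightarrow> 'i fm \<Rightarrow> bool" where
  "sat M e (Eq s t) = (eval_trm M e s = eval_trm M e t)"
| "sat M e (Mem I t) = (eval_trm M e t \<in> pred_of M I)"
| "sat M e (Neg \<phi>) = (\<not> sat M e \<phi>)"
| "sat M e (Conj \<phi> \<psi>) = (sat M e \<phi> \<and> sat M e \<psi>)"
| "sat M e (Exi i \<phi>) = (\<exists>a. sat M (e(i := a)) \<phi>)"

definition elem_equiv :: "('i, 'a) lstructure \<Rightarrow> ('i, 'b) lstructure \<Rightarrow> bool" where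
  "elem_equiv M N \<longleftrightarrow> (\<forall>\<sigma>. fv \<sigma> = {} \<longrightarrow> (\<forall>e e'. sat M e \<sigma> \<longleftrightarrow> sat N e' \<sigma>))"

text \<open>
  The pair \<open>(\<phi>, b)\<close> stands for the formula \<open>\<phi>(x, b)\<close> with parameters \<open>b\<close>: in the context of \<open>n\<close>
  object variables, \<open>Var 0, \<dots>, Var (n - 1)\<close> are the object variables \<open>x\<close>, and \<open>Var (n + j)\<close> is a
  placeholder for the parameter \<open>b ! j\<close>.
\<close>

type_synonym ('i, 'a) pfm = "'i fm \<times> 'a list"

definition pfms :: "'a set \<Rightarrow> nat \<Rightarrow> ('i, 'a) pfm set" where
  "pfms A n = {(\<phi>, b). set b \<subseteq> A \<and> fv \<phi> \<subseteq> {..<n + length b}}"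

definition holds :: "('i, 'a) lstructure \<Rightarrow> 'a list \<Rightarrow> ('i, 'a) pfm \<Rightarrow> bool" where
  "holds M xs \<psi> \<longleftrightarrow> sat M (\<lambda>i. (xs @ snd \<psi>) ! i) (fst \<psi>)"

definition solutions :: "('i, 'a) lstructure \<Rightarrow> nat \<Rightarrow> ('i, 'a) pfm \<Rightarrow> 'a list set" where
  "solutions M n \<psi> = {xs. length xs = n \<and> holds M xs \<psi>}"

definition negp :: "('i, 'a) pfm \<Rightarrow> ('i, 'a) pfm" where
  "negp \<psi> = (Neg (fst \<psi>), snd \<psi>)"

text \<open>
  Consistency of a set of formulas over \<open>M\<close> means consistency with the elementary diagram of \<open>M\<close>,
  that is (compactness) finite satisfiability in \<open>M\<close>.
\<close>

definition consistent :: "('i, 'a) lstructure \<Rightarrow> nat \<Rightarrow> ('i, 'a) pfm set \<Rightarrow> bool" where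
  "consistent M n \<Phi> \<longleftrightarrow>
     (\<forall>\<Phi>\<^sub>0. finite \<Phi>\<^sub>0 \<and> \<Phi>\<^sub>0 \<subseteq> \<Phi> \<longrightarrow> (\<exists>xs. length xs = n \<and> (\<forall>\<psi>\<in>\<Phi>\<^sub>0. holds M xs \<psi>)))"

definition complete_types :: "('i, 'a) lstructure \<Rightarrow> 'a set \<Rightarrow> nat \<Rightarrow> ('i, 'a) pfm set set" where
  "complete_types M A n =
     {p. p \<subseteq> pfms A n \<and> consistent M n p \<and> (\<forall>\<psi>\<in>pfms A n. \<psi> \<in> p \<or> negp \<psi> \<in> p)}"

definition omega_saturated :: "('i, 'a) lstructure \<Rightarrow> bool" where
  "omega_saturated M \<longleftrightarrow>
     (\<forall>A. finite A \<longrightarrow> (\<forall>p\<in>complete_types M A 1. \<exists>a. \<forall>\<psi>\<in>p. holds M [a] \<psi>))"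

text \<open>
  \<open>\<omega>\<close>-stability of the theory of \<open>S\<close>, tested on its models with universe \<open>'m\<close>.  It is meant to be
  used with a type variable \<open>'m\<close>, so that all models are covered.
\<close>

definition omega_stable :: "'m itself \<Rightarrow> ('i, 'a) lstructure \<Rightarrow> bool" where
  "omega_stable _ S \<longleftrightarrow>
     (\<forall>M :: ('i, 'm) lstructure. elem_equiv M S \<longrightarrow>
        (\<forall>A n. countable A \<longrightarrow> countable (complete_types M A n)))"

definition trivial_pfm :: "('i, 'a) pfm" where
  "trivial_pfm = (Eq (Var 0) (Var 0), [])"

text \<open>
  Notations for countable ordinals; \<open>OSup f\<close> denotes the supremum of the ordinals denoted by \<open>f n\<close>.
\<close>

datatype cord = OZero | OSucc cord | OSup "nat \<Rightarrow> cord"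

definition cord_omega :: cord where
  "cord_omega = OSup (\<lambda>n. (OSucc ^^ n) OZero)"

text \<open>
  \<open>morley_ge M \<alpha> \<psi>\<close> is the relation \<open>RM(\<psi>) \<ge> \<alpha>\<close> computed in \<open>M\<close>, for \<open>\<psi>\<close> in one object variable.
  It gives the Morley rank when \<open>M\<close> is \<open>\<omega>\<close>-saturated.
\<close>

primrec morley_ge :: "('i, 'a) lstructure \<Rightarrow> cord \<Rightarrow> ('i, 'a) pfm \<Rightarrow> bool" where
  "morley_ge M OZero = (\<lambda>\<psi>. solutions M 1 \<psi> \<noteq> {})"
| "morley_ge M (OSucc \<alpha>) = (\<lambda>\<psi>. \<exists>\<chi> :: nat \<Rightarrow> ('i, 'a) pfm.
     (\<forall>i. \<chi> i \<in> pfms UNIV 1 \<and> solutions M 1 (\<chi> i) \<subseteq> solutions M 1 \<psi> \<and> morley_ge M \<alpha> (\<chi> i)) \<and>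
     (\<forall>i j. i \<noteq> j \<longrightarrow> solutions M 1 (\<chi> i) \<inter> solutions M 1 (\<chi> j) = {}))"
| "morley_ge M (OSup f) = (\<lambda>\<psi>. \<forall>n. morley_ge M (f n) \<psi>)"

definition has_morley_rank :: "('i, 'a) lstructure \<Rightarrow> ('i, 'a) pfm \<Rightarrow> cord \<Rightarrow> bool" where
  "has_morley_rank M \<psi> \<alpha> \<longleftrightarrow> morley_ge M \<alpha> \<psi> \<and> \<not> morley_ge M (OSucc \<alpha>) \<psi>"

text \<open>
  The rows are indexed by a set \<open>K\<close>, the variable \<open>x\<close> has length \<open>n\<close>, and the parameter variables of
  row \<open>\<alpha>\<close> form a tuple of length \<open>m \<alpha>\<close>.  Inconsistency of a row refers to distinct indices \<open>i\<close>, not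
  to distinct instances: otherwise constant rows would be \<open>2\<close>-inconsistent.
\<close>

definition inp_pattern ::
  "('i, 'a) lstructure \<Rightarrow> nat \<Rightarrow> ('i, 'a) pfm set \<Rightarrow> 'k set \<Rightarrow>
   ('k \<Rightarrow> 'i fm) \<Rightarrow> ('k \<Rightarrow> nat) \<Rightarrow> bool" where
  "inp_pattern M n \<pi> K \<phi> k \<longleftrightarrow>
     (\<exists>(m :: 'k \<Rightarrow> nat) (b :: 'k \<Rightarrow> nat \<Rightarrow> 'a list).
        (\<forall>\<alpha>\<in>K. fv (\<phi> \<alpha>) \<subseteq> {..<n + m \<alpha>} \<and> (\<forall>i. length (b \<alpha> i) = m \<alpha>)) \<and>
        (\<forall>\<alpha>\<in>K. \<forall>I. finite I \<and> card I = k \<alpha> \<longrightarrow> \<not> consistent M n ((\<lambda>i. (\<phi> \<alpha>, b \<alpha> i)) ` I)) \<and>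
        (\<forall>\<eta> :: 'k \<Rightarrow> nat. consistent M n (\<pi> \<union> (\<lambda>\<alpha>. (\<phi> \<alpha>, b \<alpha> (\<eta> \<alpha>))) ` K)))"

text \<open>
  The dp-rank in a stable theory, computed in a sufficiently saturated model \<open>M\<close>, with all infinite
  cardinals identified to \<open>\<infinity>\<close>.  A cardinal \<open>\<kappa> \<le> \<omega>\<close> is the initial segment
  \<open>{\<alpha>. enat \<alpha> < \<kappa>}\<close> of the naturals; greater depths need not be considered, since discarding rows
  of a pattern of depth \<open>\<kappa> > \<omega>\<close> leaves one of depth \<open>\<omega>\<close>.  For \<open>\<pi>\<close> with finitely many parameters,
  \<open>\<omega>\<close>-saturation suffices, because it gives realizations of types in countably many variables
  over finite sets.
\<close>

definition dp_rank :: "('i, 'a) lstructure \<Rightarrow> nat \<Rightarrow> ('i, 'a) pfm set \<Rightarrow> enat" where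
  "dp_rank M n \<pi> = Sup {\<kappa>. \<exists>\<phi> k. inp_pattern M n \<pi> {\<alpha>::nat. enat \<alpha> < \<kappa>} \<phi> k}"

text \<open>
  Finitely supported functions \<open>nat \<Rightarrow>\<^sub>0 rat\<close> form the direct sum of countably many copies of the
  rationals, and \<open>nat fset\<close> is the collection of all finite sets of naturals.
\<close>

definition H :: "nat fset \<Rightarrow> (nat \<Rightarrow>\<^sub>0 rat) set" where
  "H I = {g. \<forall>i. i \<notin> fset I \<longrightarrow> Poly_Mapping.lookup g i = 0}"

definition G_struct :: "(nat fset, nat \<Rightarrow>\<^sub>0 rat) lstructure" where
  "G_struct = \<lparr>zero_of = 0, plus_of = (+), minus_of = uminus, pred_of = H\<rparr>"

end

(*
  The proof rests on elimination of quantifiers for models of the theory of G_struct.  There the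
  subgroups H_I, together with the whole group, form a distributive lattice of divisible subgroups,
  so a system of congruences "y = r_k modulo H_(I_k)" is solvable as soon as any two of them are
  compatible, and no class of H_I is covered by finitely many classes of subgroups that do not
  contain H_I.  Hence the truth of a formula depends only on finitely many conditions "f in H_I"
  with f a linear form.

  Conjunctions of such conditions satisfy the descending chain condition, so a complete type is
  determined by finitely many of its atomic formulas: this is omega-stability.  A definable subset
  of a class of H_I agrees, up to finitely many classes of smaller subgroups, with the empty set or
  the whole class, so H_I has Morley rank |I| and the whole group has rank omega.  The classes of
  H_(D - {i}) for i in D, all taken inside one class of H_D, form an inp-pattern of depth |D|.
*)
theory Submission
  imports Defs "HOL-Algebra.Group"
begin

section \<open>Congruences modulo a lattice of subgroups\<close>

text \<open>Types and ranks are handled in arbitrary models, whose elements have no coordinates and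
  may lie outside every \<open>H_I\<close>. The argument therefore uses only the assumptions of
  \<open>subgroup_family\<close>, which all follow from first-order sentences true in
  \<open>G_struct\<close>. There \<open>K\<close> turns unions of index sets into sums of subgroups
  and intersections into intersections, so the distributive law of sets is what reduces a system of
  congruences to its pairs. Purity makes the quotients by \<open>K S\<close> torsion-free: a line
  meeting a class in two points then lies inside it, and a condition on \<open>f\<close> may be
  replaced by one on a nonzero multiple of \<open>f\<close>. The latter matters because solving for
  a variable requires division, which the terms of the language do not have. Elimination is stated
  semantically: assignments that agree on finitely many conditions give a formula the same truth
  value. Negation is then trivial, and a quantifier becomes a back-and-forth step in one
  coordinate.\<close>

definition idx :: "nat set set" where
  "idx = {S. finite S \<or> S = UNIV}"

lemma idx_Int [simp]: "S \<in> idx \<Longrightarrow> T \<in> idx \<Longrightarrow> S \<inter> T \<in> idx"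
  and idx_Un [simp]: "S \<in> idx \<Longrightarrow> T \<in> idx \<Longrightarrow> S \<union> T \<in> idx"
  and idx_UNIV [simp]: "UNIV \<in> idx"
  and idx_finite [simp]: "finite S \<Longrightarrow> S \<in> idx"
  by (auto simp: idx_def)

text \<open>The empty intersection is \<open>UNIV\<close>, the index of the whole group, so a system
  without congruences needs no separate case below.\<close>

lemma idx_Inter: "finite \<S> \<Longrightarrow> \<S> \<subseteq> idx \<Longrightarrow> \<Inter>\<S> \<in> idx"
  by (induction \<S> rule: finite_induct) auto

text \<open>\<open>K_subset_imp\<close> supplies elements of \<open>K S\<close> outside
  \<open>K T\<close>. \<open>K_pure\<close> makes every quotient torsion-free, and with
  \<open>K_empty\<close> the group itself; with \<open>divisible\<close> it makes every
  \<open>K S\<close> divisible.\<close>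

locale subgroup_family = comm_group G for G (structure) +
  fixes K :: "nat set \<Rightarrow> 'a set"
  assumes carrier [simp]: "carrier G = UNIV"
    and K_subgroup: "subgroup (K S) G"
    and K_UNIV [simp]: "K UNIV = UNIV"
    and K_empty: "K {} = {\<one>}"
    and K_Int: "S \<in> idx \<Longrightarrow> T \<in> idx \<Longrightarrow> K (S \<inter> T) = K S \<inter> K T"
    and K_Un: "S \<in> idx \<Longrightarrow> T \<in> idx \<Longrightarrow> x \<in> K (S \<union> T) \<Longrightarrow> \<exists>y\<in>K S. x \<otimes> inv y \<in> K T"
    and K_subset_imp: "S \<in> idx \<Longrightarrow> T \<in> idx \<Longrightarrow> K S \<subseteq> K T \<Longrightarrow> S \<subseteq> T"
    and K_pure: "0 < n \<Longrightarrow> x [^] (n :: nat) \<in> K S \<Longrightarrow> x \<in> K S"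
    and divisible: "0 < n \<Longrightarrow> \<exists>y. y [^] (n :: nat) = x"
begin

lemma inv_cancel [simp]: "inv x \<otimes> (x \<otimes> y) = y" "x \<otimes> (inv x \<otimes> y) = y"
  by (simp_all flip: m_assoc)

lemma K_mono: "S \<in> idx \<Longrightarrow> T \<in> idx \<Longrightarrow> S \<subseteq> T \<Longrightarrow> K S \<subseteq> K T"
  by (metis K_Int inf.absorb1 inf.cobounded2)

lemma K_one [simp]: "\<one> \<in> K S"
  and K_mult: "x \<in> K S \<Longrightarrow> y \<in> K S \<Longrightarrow> x \<otimes> y \<in> K S"
  and K_inv: "x \<in> K S \<Longrightarrow> inv x \<in> K S"
  using K_subgroup by (auto intro: subgroup.one_closed subgroup.m_closed subgroup.m_inv_closed)

lemma K_inv_iff [simp]: "inv x \<in> K S \<longleftrightarrow> x \<in> K S"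
  by (metis K_inv inv_inv UNIV_I carrier)

lemma K_pow: "d \<in> K S \<Longrightarrow> d [^] (m :: nat) \<in> K S"
  by (induction m) (auto intro: K_mult)

lemma K_pow_iff: "0 < n \<Longrightarrow> x [^] (n :: nat) \<in> K S \<longleftrightarrow> x \<in> K S"
  using K_pure K_pow by blast

lemma int_pow_cases:
  assumes "z \<noteq> 0"
  obtains n :: nat where "0 < n" "\<And>x. x [^] (z :: int) = x [^] n"
    | n :: nat where "0 < n" "\<And>x. x [^] (z :: int) = inv (x [^] n)"
proof (cases "z < 0")
  case True
  then show ?thesis
    using that(2)[of "nat (- z)"] unfolding int_pow_def2 by simp
next
  case False
  then show ?thesis
    using that(1)[of "nat z"] assms unfolding int_pow_def2 by simp
qed

lemma K_int_pow_iff: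
  assumes "z \<noteq> 0"
  shows "x [^] (z :: int) \<in> K S \<longleftrightarrow> x \<in> K S"
  using assms by (cases rule: int_pow_cases) (simp_all add: K_pow_iff)

lemma int_divisible:
  assumes "z \<noteq> 0"
  shows "\<exists>y. y [^] (z :: int) = x"
  using assms
proof (cases rule: int_pow_cases)
  case (1 n)
  then show ?thesis
    using divisible by metis
next
  case (2 n)
  obtain y where "y [^] n = inv x"
    using divisible 2 by metis
  then show ?thesis
    using 2 by (metis carrier inv_inv UNIV_I)
qed

section \<open>Congruences: simultaneous solvability, non-covering, back-and-forth\<close>

definition cg :: "nat set \<Rightarrow> 'a \<Rightarrow> 'a \<Rightarrow> bool" where
  "cg S x y \<longleftrightarrow> x \<otimes> inv y \<in> K S"

lemma cg_refl [simp]: "cg S x x"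
  by (simp add: cg_def)

lemma cg_sym: "cg S x y \<Longrightarrow> cg S y x"
  unfolding cg_def using K_inv[of "x \<otimes> inv y" S] by (simp add: inv_mult m_comm)

lemma cg_trans:
  assumes "cg S x y" "cg S y z"
  shows "cg S x z"
proof -
  have "x \<otimes> inv z = (x \<otimes> inv y) \<otimes> (y \<otimes> inv z)"
    by (simp add: m_assoc)
  then show ?thesis
    using assms K_mult unfolding cg_def by metis
qed

lemma cg_UNIV [simp]: "cg UNIV x y"
  by (simp add: cg_def)

lemma cg_mono: "S \<in> idx \<Longrightarrow> T \<in> idx \<Longrightarrow> S \<subseteq> T \<Longrightarrow> cg S x y \<Longrightarrow> cg T x y"
  using K_mono by (auto simp: cg_def)

lemma cg_UnI1: "S \<in> idx \<Longrightarrow> T \<in> idx \<Longrightarrow> cg S x y \<Longrightarrow> cg (S \<union> T) x y"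
  and cg_UnI2: "S \<in> idx \<Longrightarrow> T \<in> idx \<Longrightarrow> cg T x y \<Longrightarrow> cg (S \<union> T) x y"
  by (auto intro: cg_mono[of S "S \<union> T"] cg_mono[of T "S \<union> T"])

lemma cg_Int: "S \<in> idx \<Longrightarrow> T \<in> idx \<Longrightarrow> cg (S \<inter> T) x y \<longleftrightarrow> cg S x y \<and> cg T x y"
  using K_Int by (auto simp: cg_def)

lemma cg_Inter:
  "finite \<S> \<Longrightarrow> \<S> \<subseteq> idx \<Longrightarrow> cg (\<Inter>\<S>) x y \<longleftrightarrow> (\<forall>S\<in>\<S>. cg S x y)"
  by (induction \<S> rule: finite_induct) (auto simp: cg_Int idx_Inter)

lemma cg_Un:
  assumes "S \<in> idx" "T \<in> idx" "cg (S \<union> T) x y"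
  shows "\<exists>z. cg S x z \<and> cg T z y"
proof -
  obtain u where u: "u \<in> K S" "(x \<otimes> inv y) \<otimes> inv u \<in> K T"
    using K_Un assms unfolding cg_def by blast
  define z where "z = x \<otimes> inv u"
  have "x \<otimes> inv z = u"
    by (simp add: z_def inv_mult flip: m_assoc)
  moreover have "z \<otimes> inv y = (x \<otimes> inv y) \<otimes> inv u"
    by (simp add: z_def m_ac)
  ultimately show ?thesis
    using u unfolding cg_def by metis
qed

text \<open>A solution \<open>y\<close> of the old congruences is congruent to the new
  \<open>r\<close> modulo every \<open>S \<union> S'\<close>, hence modulo
  \<open>S \<union> T\<close> with \<open>T\<close> the intersection of the old index sets. By
  \<open>cg_Un\<close> it can be moved inside its class modulo \<open>T\<close> until it is
  congruent to \<open>r\<close> modulo \<open>S\<close>.\<close>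

lemma chinese_remainder:
  assumes "finite P" "snd ` P \<subseteq> idx"
    and "\<And>r S r' S'. (r, S) \<in> P \<Longrightarrow> (r', S') \<in> P \<Longrightarrow> cg (S \<union> S') r r'"
  shows "\<exists>y. \<forall>(r, S)\<in>P. cg S y r"
  using assms
proof (induction P rule: finite_induct)
  case (insert p P)
  obtain r S where p: "p = (r, S)"
    by fastforce
  obtain y where y: "\<forall>(r, S)\<in>P. cg S y r"
    using insert by blast
  define T where "T = \<Inter>(snd ` P)"
  have idx: "S \<in> idx" "T \<in> idx" "snd ` P \<subseteq> idx"
    using insert.prems p insert.hyps unfolding T_def by (auto intro: idx_Inter)
  have "cg (S \<union> S') y r" if "(r', S') \<in> P" for r' S'
  proof -
    have "cg (S \<union> S') y r'"
      using y that idx by (force intro: cg_mono[of S'])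
    moreover have "cg (S \<union> S') r' r"
      using insert.prems(2)[of r' S' r S] that p by (simp add: Un_commute)
    ultimately show ?thesis
      by (rule cg_trans)
  qed
  then have "\<forall>R\<in>(\<lambda>q. S \<union> snd q) ` P. cg R y r"
    by auto
  moreover have "(\<lambda>q. S \<union> snd q) ` P \<subseteq> idx"
    using idx by auto
  ultimately have "cg (\<Inter>((\<lambda>q. S \<union> snd q) ` P)) y r"
    using insert.hyps by (subst cg_Inter) auto
  \<comment> \<open>The distributive law: this is why pairwise compatibility is enough.\<close>
  moreover have "\<Inter>((\<lambda>q. S \<union> snd q) ` P) = T \<union> S"
    unfolding T_def by auto
  ultimately have "cg (T \<union> S) y r"
    by simp
  then obtain z where z: "cg T y z" "cg S z r"
    using cg_Un idx by blast
  have "cg S' z r'" if "(r', S') \<in> P" for r' S'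
  proof -
    have "cg S' y z"
      using z(1) idx that by (intro cg_mono[of T S']) (auto simp: T_def)
    then show ?thesis
      using y that cg_sym cg_trans by (metis case_prodD)
  qed
  with z(2) show ?case
    unfolding p by blast
qed simp

text \<open>Two points of an arithmetic progression in one class would put a positive multiple of
  the difference \<open>d\<close> into \<open>K T\<close>, and then \<open>d\<close> itself by
  purity.\<close>

lemma cg_pow_seq:
  assumes "d \<notin> K T" "cg T a (y \<otimes> d [^] m)" "cg T a (y \<otimes> d [^] (n :: nat))"
  shows "m = n"
proof -
  have *: "m \<ge> n" if "cg T a (y \<otimes> d [^] m)" "cg T a (y \<otimes> d [^] n)" for m n :: nat
  proof (rule ccontr)
    assume "\<not> m \<ge> n"
    then have n: "n = m + (n - m)" "n - m > 0"
      by auto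
    have "(y \<otimes> d [^] n) \<otimes> inv (y \<otimes> d [^] m) = d [^] (n - m)"
    proof -
      have "d [^] n = d [^] m \<otimes> d [^] (n - m)"
        by (subst n(1)) (simp add: nat_pow_mult)
      then have "y \<otimes> d [^] n = d [^] (n - m) \<otimes> (y \<otimes> d [^] m)"
        by (simp add: m_ac)
      then show ?thesis
        by (simp add: m_assoc)
    qed
    moreover have "cg T (y \<otimes> d [^] n) (y \<otimes> d [^] m)"
      using that cg_sym cg_trans by blast
    ultimately show False
      using assms(1) K_pow_iff n(2) unfolding cg_def by auto
  qed
  show ?thesis
    using *[of m n] *[of n m] assms by auto
qed

lemma cg_mult_right:
  assumes "d \<in> K S"
  shows "cg S y (y \<otimes> d)"
  using assms by (simp add: cg_def inv_mult flip: m_assoc)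

lemma infinite_classes:
  assumes "S \<in> idx" "T \<in> idx" "\<not> S \<subseteq> T"
  obtains a :: "nat \<Rightarrow> 'a"
  where "\<And>m. cg S x (a m)" "\<And>m n. m \<noteq> n \<Longrightarrow> \<not> cg T (a m) (a n)"
proof -
  obtain d where d: "d \<in> K S" "d \<notin> K T"
    using K_subset_imp assms by blast
  show ?thesis
  proof (rule that[of "\<lambda>m. x \<otimes> d [^] m"])
    show "cg S x (x \<otimes> d [^] m)" for m :: nat
      using d by (intro cg_mult_right K_pow)
    show "\<not> cg T (x \<otimes> d [^] m) (x \<otimes> d [^] n)" if "m \<noteq> n" for m n :: nat
      using cg_pow_seq[OF d(2), of "x \<otimes> d [^] m" x m n] that by auto
  qed
qed

text \<open>
  The step of the induction moves along a line \<open>y + m d\<close>, which meets each of the forbidden classes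
  in at most one point or else misses it.
\<close>

lemma class_not_covered:
  assumes "S \<in> idx" "finite P" "\<And>a T. (a, T) \<in> P \<Longrightarrow> T \<in> idx \<and> \<not> S \<subseteq> T"
  shows "\<exists>y. cg S x y \<and> (\<forall>(a, T)\<in>P. \<not> cg T a y)"
  using assms(2,3)
proof (induction P rule: finite_induct)
  case empty
  show ?case
    by (intro exI[of _ x]) simp
next
  case (insert p P)
  obtain a T where p: "p = (a, T)"
    by fastforce
  have "\<exists>y. cg S x y \<and> (\<forall>(a, T)\<in>P. \<not> cg T a y)"
    using insert.prems by (intro insert.IH) auto
  then obtain y where y: "cg S x y" "\<forall>(a, T)\<in>P. \<not> cg T a y"
    by auto
  obtain d where d: "d \<in> K S" "d \<notin> K T"
    using K_subset_imp[of S T] assms(1) insert.prems[of a T] p by auto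
  define B where "B = (\<lambda>(a, T). {m :: nat. cg T a (y \<otimes> d [^] m)})"
  have "finite (B q)" if "q \<in> insert p P" for q
  proof -
    obtain b R where q: "q = (b, R)"
      by fastforce
    show ?thesis
    proof (cases "d \<in> K R")
      case True
      then have "q \<in> P"
        using d q p that by auto
      have "\<not> cg R b (y \<otimes> d [^] m)" for m :: nat
        using cg_mult_right[OF K_pow[OF True], of y m] y(2) \<open>q \<in> P\<close> q cg_sym cg_trans
        by (metis case_prodD)
      then show ?thesis
        by (simp add: B_def q)
    next
      case False
      then have "m = n" if "m \<in> B q" "n \<in> B q" for m n
        using that cg_pow_seq by (simp add: B_def q)
      then have "B q \<subseteq> {SOME m. m \<in> B q}"
        by (metis singletonI someI subsetI)
      then show ?thesis
        using finite_subset by blast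
    qed
  qed
  then have "finite (\<Union> (B ` insert p P))"
    using insert.hyps by blast
  then obtain m where m: "m \<notin> \<Union> (B ` insert p P)"
    using ex_new_if_finite infinite_UNIV_nat by blast
  have "cg S x (y \<otimes> d [^] m)"
    using y(1) cg_mult_right[OF K_pow[OF d(1)]] cg_trans by blast
  then show ?case
    using m unfolding B_def by (intro exI[of _ "y \<otimes> d [^] m"]) auto
qed

text \<open>The congruences that \<open>y\<close> satisfies are pairwise compatible, hence so are
  their primed versions, and \<open>z\<close> solves these. The remaining task is to satisfy no
  further congruence, which takes a generic point \<open>y'\<close> of the class of \<open>z\<close>
  modulo \<open>T\<close>.\<close>

lemma back_and_forth:
  assumes "finite N" "\<And>k. k \<in> N \<Longrightarrow> S k \<in> idx"
    and agree: "\<And>k l. k \<in> N \<Longrightarrow> l \<in> N \<Longrightarrow>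
      cg (S k \<union> S l) (r k) (r l) \<longleftrightarrow> cg (S k \<union> S l) (r' k) (r' l)"
  shows "\<exists>y'. \<forall>k\<in>N. cg (S k) y (r k) \<longleftrightarrow> cg (S k) y' (r' k)"
proof -
  define N1 where "N1 = {k \<in> N. cg (S k) y (r k)}"
  have N1: "finite N1" "N1 \<subseteq> N"
    using assms by (auto simp: N1_def)
  define T where "T = \<Inter>(S ` N1)"
  have T: "T \<in> idx"
    using N1 assms(2) unfolding T_def by (auto intro!: idx_Inter)
  have "\<exists>z. \<forall>(s, R)\<in>(\<lambda>k. (r' k, S k)) ` N1. cg R z s"
  proof (rule chinese_remainder)
    fix s R s' R'
    assume "(s, R) \<in> (\<lambda>k. (r' k, S k)) ` N1" "(s', R') \<in> (\<lambda>k. (r' k, S k)) ` N1"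
    then obtain k l where kl: "k \<in> N1" "l \<in> N1" "s = r' k" "R = S k" "s' = r' l" "R' = S l"
      by auto
    have "cg (S k \<union> S l) y (r k)" "cg (S k \<union> S l) y (r l)"
      using kl assms(2) N1 by (auto simp: N1_def intro: cg_mono[of "S k"] cg_mono[of "S l"])
    then show "cg (R \<union> R') s s'"
      using agree[of k l] kl N1 cg_sym cg_trans by blast
  qed (use N1 assms(2) in auto)
  then obtain z where z: "\<And>k. k \<in> N1 \<Longrightarrow> cg (S k) z (r' k)"
    by auto
  \<comment> \<open>Only classes with \<open>\<not> T \<subseteq> S l\<close> can be avoided; a
    class with \<open>T \<subseteq> S l\<close> contains all of the class of \<open>z\<close> or
    misses it, and is dealt with afterwards.\<close>
  let ?P = "{(r' l, S l) | l. l \<in> N \<and> \<not> T \<subseteq> S l}"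
  have "\<exists>y'. cg T z y' \<and> (\<forall>(a, R)\<in>?P. \<not> cg R a y')"
  proof (rule class_not_covered[OF T])
    have "?P = (\<lambda>l. (r' l, S l)) ` {l \<in> N. \<not> T \<subseteq> S l}"
      by auto
    then show "finite ?P"
      using assms(1) by simp
  qed (use assms(2) in auto)
  then obtain y' where y': "cg T z y'" "\<And>l. l \<in> N \<Longrightarrow> \<not> T \<subseteq> S l \<Longrightarrow> \<not> cg (S l) (r' l) y'"
    by blast
  have y'_N1: "cg (S k) y' (r' k)" if "k \<in> N1" for k
  proof -
    have "cg (S k) z y'"
      using y'(1) that N1 assms(2) T by (intro cg_mono[of T "S k"]) (auto simp: T_def)
    then show ?thesis
      using z[OF that] cg_sym cg_trans by blast
  qed
  have "k \<in> N1" if k: "k \<in> N" "cg (S k) y' (r' k)" for k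
  proof -
    have sub: "T \<subseteq> S k"
      using y'(2) k cg_sym by blast
    \<comment> \<open>The point \<open>y'\<close> shows that \<open>r' l\<close> and
      \<open>r' k\<close> are compatible; this transfers to \<open>r l\<close> and
      \<open>r k\<close>, so \<open>y\<close> is congruent to \<open>r k\<close> modulo each
      \<open>S l \<union> S k\<close>. Since \<open>T \<subseteq> S k\<close>, these sets intersect
      in \<open>S k\<close>.\<close>
    have "cg (S l \<union> S k) y (r k)" if l: "l \<in> N1" for l
    proof -
      have lN: "l \<in> N" and idx: "S l \<in> idx" "S k \<in> idx" and yl: "cg (S l) y (r l)"
        using l k assms(2) unfolding N1_def by auto
      have "cg (S l \<union> S k) (r' l) y'" "cg (S l \<union> S k) y' (r' k)"
        using cg_UnI1[OF idx cg_sym[OF y'_N1[OF l]]] cg_UnI2[OF idx k(2)] by auto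
      then have "cg (S l \<union> S k) (r l) (r k)"
        using agree[OF lN k(1)] cg_trans by blast
      then show ?thesis
        using cg_UnI1[OF idx yl] cg_trans by blast
    qed
    then have "cg (\<Inter>((\<lambda>l. S l \<union> S k) ` N1)) y (r k)"
      using N1 assms(2) k by (subst cg_Inter) auto
    moreover have "(\<Inter>((\<lambda>l. S l \<union> S k) ` N1)) = S k"
      using sub unfolding T_def by auto
    ultimately show ?thesis
      using k by (simp add: N1_def)
  qed
  then show ?thesis
    using y'_N1 by (intro exI[of _ y']) (auto simp: N1_def)
qed

end

section \<open>Linear forms\<close>

context subgroup_family
begin

text \<open>These are the affine forms with rational coefficients, seen as functions of the
  assignment; \<open>lin_root\<close> provides the division needed to solve for a variable.
  \<open>C\<close> holds the admissible constants: none for parameter-free elimination, all elements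
  when the parameters of a type are absorbed into the forms.\<close>

inductive_set lin :: "'a set \<Rightarrow> nat set \<Rightarrow> ((nat \<Rightarrow> 'a) \<Rightarrow> 'a) set"
  for C :: "'a set" and V :: "nat set"
where
  lin_var: "i \<in> V \<Longrightarrow> (\<lambda>e. e i) \<in> lin C V"
| lin_const: "a \<in> C \<Longrightarrow> (\<lambda>_. a) \<in> lin C V"
| lin_one: "(\<lambda>_. \<one>) \<in> lin C V"
| lin_mult: "f \<in> lin C V \<Longrightarrow> g \<in> lin C V \<Longrightarrow> (\<lambda>e. f e \<otimes> g e) \<in> lin C V"
| lin_inv: "f \<in> lin C V \<Longrightarrow> (\<lambda>e. inv (f e)) \<in> lin C V"
| lin_root: "f \<in> lin C V \<Longrightarrow> n \<noteq> 0 \<Longrightarrow> (\<And>e. g e [^] (n :: int) = f e) \<Longrightarrow> g \<in> lin C V"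

lemma int_pow_inj:
  assumes "z \<noteq> 0" "x [^] (z :: int) = y [^] z"
  shows "x = y"
proof -
  have "(x \<otimes> inv y) [^] z = x [^] z \<otimes> inv (y [^] z)"
    by (simp add: int_pow_distrib int_pow_inv)
  then have "x \<otimes> inv y \<in> K {}"
    using assms K_int_pow_iff[of z "x \<otimes> inv y"] by simp
  then show ?thesis
    by (simp add: K_empty inv_equality inv_solve_right')
qed

lemma lin_cong: "f \<in> lin C V \<Longrightarrow> (\<And>i. i \<in> V \<Longrightarrow> e i = e' i) \<Longrightarrow> f e = f e'"
proof (induction f rule: lin.induct)
  case (lin_root f n g)
  then show ?case
    by (metis int_pow_inj)
qed auto

lemma lin_mono: "f \<in> lin C V \<Longrightarrow> V \<subseteq> V' \<Longrightarrow> f \<in> lin C V'"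
  by (induction f rule: lin.induct) (auto intro: lin.intros)

lemma lin_subst:
  assumes "f \<in> lin C V" "C \<subseteq> C'" "\<And>i. i \<in> V \<Longrightarrow> (\<lambda>e. \<sigma> e i) \<in> lin C' V'"
  shows "(\<lambda>e. f (\<sigma> e)) \<in> lin C' V'"
  using assms(1)
proof (induction f rule: lin.induct)
  case (lin_root f n g)
  then show ?case
    using lin.lin_root[of "\<lambda>e. f (\<sigma> e)" C' V' n "\<lambda>e. g (\<sigma> e)"] by blast
qed (use assms(2,3) in \<open>auto intro: lin.intros\<close>)

lemma lin_int_pow:
  assumes "f \<in> lin C V"
  shows "(\<lambda>e. f e [^] (z :: int)) \<in> lin C V"
proof -
  have *: "(\<lambda>e. f e [^] (n :: nat)) \<in> lin C V" for n
    by (induction n) (use assms in \<open>auto intro: lin_one lin_mult\<close>)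
  show ?thesis
    unfolding int_pow_def2
    using *[of "nat z"] lin_inv[OF *[of "nat (- z)"]] by (cases "z < 0") simp_all
qed

text \<open>The multiplier \<open>n\<close> clears the denominators introduced by
  \<open>lin_root\<close>, so that the coefficient \<open>z\<close> of the variable is an
  integer.\<close>

lemma lin_split:
  assumes "f \<in> lin C V"
  shows "\<exists>n z. \<exists>g\<in>lin C (V - {y}). n \<noteq> 0 \<and> (\<forall>e. f e [^] (n :: int) = e y [^] (z :: int) \<otimes> g e)"
  using assms
proof (induction f rule: lin.induct)
  case (lin_var i)
  show ?case
  proof (cases "i = y")
    case True
    then show ?thesis
      by (intro exI[of _ 1] exI[of _ 1] bexI[OF _ lin_one]) auto
  next
    case False
    then show ?thesis
      using lin_var by (intro exI[of _ 1] exI[of _ 0] bexI[OF _ lin.lin_var[of i]]) auto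
  qed
next
  case (lin_const a)
  then show ?case
    by (intro exI[of _ 1] exI[of _ 0] bexI[OF _ lin.lin_const[of a]]) auto
next
  case lin_one
  then show ?case
    by (intro exI[of _ 1] exI[of _ 0] bexI[OF _ lin.lin_one]) auto
next
  case (lin_mult f f')
  from lin_mult.IH(1) obtain n z :: int and g where
    g: "g \<in> lin C (V - {y})" "n \<noteq> 0" "\<forall>e. f e [^] n = e y [^] z \<otimes> g e"
    by blast
  from lin_mult.IH(2) obtain n' z' :: int and g' where
    g': "g' \<in> lin C (V - {y})" "n' \<noteq> 0" "\<forall>e. f' e [^] n' = e y [^] z' \<otimes> g' e"
    by blast
  have "(f e \<otimes> f' e) [^] (n * n') = e y [^] (z * n' + z' * n) \<otimes> (g e [^] n' \<otimes> g' e [^] n)" for e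
  proof -
    have "(f e \<otimes> f' e) [^] (n * n') = (f e [^] n) [^] n' \<otimes> (f' e [^] n') [^] n"
      by (simp add: int_pow_distrib int_pow_pow mult.commute)
    then show ?thesis
      by (simp add: g g' int_pow_distrib int_pow_pow int_pow_mult m_ac)
  qed
  then show ?case
    using g g' by (intro exI[of _ "n * n'"] exI[of _ "z * n' + z' * n"]
        bexI[OF _ lin.lin_mult[OF lin_int_pow[of g _ _ n'] lin_int_pow[of g' _ _ n]]]) auto
next
  case (lin_inv f)
  then obtain n z :: int and g where
    g: "g \<in> lin C (V - {y})" "n \<noteq> 0" "\<forall>e. f e [^] n = e y [^] z \<otimes> g e"
    by blast
  have "inv (f e) [^] n = e y [^] (- z) \<otimes> inv (g e)" for e
    by (simp add: int_pow_inv g int_pow_neg inv_mult)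
  then show ?case
    using g by (intro exI[of _ n] exI[of _ "- z"] bexI[OF _ lin.lin_inv[of g]]) auto
next
  case (lin_root f m h)
  then obtain n z :: int and g where
    g: "g \<in> lin C (V - {y})" "n \<noteq> 0" "\<forall>e. f e [^] n = e y [^] z \<otimes> g e"
    by blast
  have "h e [^] (m * n) = e y [^] z \<otimes> g e" for e
    using lin_root.hyps(3)[of e] spec[OF g(3), of e] by (simp flip: int_pow_pow)
  then show ?case
    using g lin_root.hyps(2) by (intro exI[of _ "m * n"] exI[of _ z] bexI[of _ g]) auto
qed

section \<open>Eliminating one variable\<close>

text \<open>
  \<open>g f\<close> is the value of the variable \<open>y\<close> that solves \<open>f = 0\<close> if \<open>b f\<close> holds, that is if \<open>y\<close> occurs
  in \<open>f\<close>; otherwise it is a multiple of \<open>f\<close>.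
\<close>

definition elim :: "'a set \<Rightarrow> nat set \<Rightarrow> nat \<Rightarrow> (((nat \<Rightarrow> 'a) \<Rightarrow> 'a) \<Rightarrow> bool) \<Rightarrow>
    (((nat \<Rightarrow> 'a) \<Rightarrow> 'a) \<Rightarrow> (nat \<Rightarrow> 'a) \<Rightarrow> 'a) \<Rightarrow> bool" where
  "elim C V y b g \<longleftrightarrow> (\<forall>f\<in>lin C V. g f \<in> lin C (V - {y}) \<and>
     (\<forall>e S. f e \<in> K S \<longleftrightarrow> (if b f then cg S (e y) (g f e) else g f e \<in> K S)))"

text \<open>After clearing denominators the condition reads \<open>z y + g\<close> in
  \<open>K S\<close>. If \<open>z\<close> is not zero, purity allows division by \<open>z\<close>,
  which gives \<open>y\<close> congruent to \<open>- g / z\<close> with the same right-hand side for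
  every \<open>S\<close>.\<close>

lemma ex_elim: "\<exists>b g. elim C V y b g"
proof -
  have "\<exists>p. snd p \<in> lin C (V - {y}) \<and>
     (\<forall>e S. f e \<in> K S \<longleftrightarrow> (if fst p then cg S (e y) (snd p e) else snd p e \<in> K S))"
    if f: "f \<in> lin C V" for f
  proof -
    obtain n z g where
      g: "g \<in> lin C (V - {y})" "n \<noteq> 0" "\<And>e. f e [^] (n :: int) = e y [^] (z :: int) \<otimes> g e"
      using lin_split[OF f, of y] by auto
    have f_iff: "f e \<in> K S \<longleftrightarrow> e y [^] z \<otimes> g e \<in> K S" for e S
      using g(2) g(3)[of e] K_int_pow_iff[of n "f e" S] by simp
    show ?thesis
    proof (cases "z = 0")
      case True
      then show ?thesis
        using g(1) f_iff by (intro exI[of _ "(False, g)"]) simp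
    next
      case False
      define r where "r e = (SOME a. a [^] z = inv (g e))" for e
      have r: "r e [^] z = inv (g e)" for e
        unfolding r_def using int_divisible[OF False] by (rule someI_ex)
      have "r \<in> lin C (V - {y})"
        using lin_root[OF lin_inv[OF g(1)] False] r by blast
      moreover have "f e \<in> K S \<longleftrightarrow> cg S (e y) (r e)" for e S
      proof -
        have "e y [^] z \<otimes> g e = e y [^] z \<otimes> inv (r e [^] z)"
          using r[of e] by simp
        also have "\<dots> = (e y \<otimes> inv (r e)) [^] z"
          by (simp add: int_pow_distrib int_pow_inv)
        finally show ?thesis
          using f_iff K_int_pow_iff[OF False] by (simp add: cg_def)
      qed
      ultimately show ?thesis
        by (intro exI[of _ "(True, r)"]) simp
    qed
  qed
  then obtain p where "\<And>f. f \<in> lin C V \<Longrightarrow> snd (p f) \<in> lin C (V - {y}) \<and>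
     (\<forall>e S. f e \<in> K S \<longleftrightarrow> (if fst (p f) then cg S (e y) (snd (p f) e) else snd (p f) e \<in> K S))"
    by metis
  then show ?thesis
    unfolding elim_def by (intro exI[of _ "\<lambda>f. fst (p f)"] exI[of _ "\<lambda>f. snd (p f)"]) blast
qed

definition sol :: "(((nat \<Rightarrow> 'a) \<Rightarrow> 'a) \<times> nat set) set \<Rightarrow> (nat \<Rightarrow> 'a) set" where
  "sol P = {e. \<forall>(f, S)\<in>P. f e \<in> K S}"

definition agree :: "(((nat \<Rightarrow> 'a) \<Rightarrow> 'a) \<times> nat set) set \<Rightarrow> (nat \<Rightarrow> 'a) \<Rightarrow> (nat \<Rightarrow> 'a) \<Rightarrow> bool" where
  "agree P e e' \<longleftrightarrow> (\<forall>(f, S)\<in>P. f e \<in> K S \<longleftrightarrow> f e' \<in> K S)"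

text \<open>The conditions left after quantifying over \<open>y\<close>: those without
  \<open>y\<close> are kept, and each pair of congruences on \<open>y\<close> contributes its
  compatibility condition.\<close>

definition proj :: "(((nat \<Rightarrow> 'a) \<Rightarrow> 'a) \<Rightarrow> bool) \<Rightarrow> (((nat \<Rightarrow> 'a) \<Rightarrow> 'a) \<Rightarrow> (nat \<Rightarrow> 'a) \<Rightarrow> 'a) \<Rightarrow>
    (((nat \<Rightarrow> 'a) \<Rightarrow> 'a) \<times> nat set) set \<Rightarrow> (((nat \<Rightarrow> 'a) \<Rightarrow> 'a) \<times> nat set) set" where
  "proj b g P = (\<lambda>(f, S). (g f, S)) ` {(f, S) \<in> P. \<not> b f} \<union>
     (\<lambda>((f, S), (f', S')). (\<lambda>e. g f e \<otimes> inv (g f' e), S \<union> S')) `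
       ({(f, S) \<in> P. b f} \<times> {(f, S) \<in> P. b f})"

lemma proj_mono: "P \<subseteq> P' \<Longrightarrow> proj b g P \<subseteq> proj b g P'"
  unfolding proj_def by (intro Un_mono image_mono Sigma_mono) auto

lemma proj_finite:
  assumes "finite P"
  shows "finite (proj b g P)"
proof -
  have "finite {(f, S) \<in> P. b f}" "finite {(f, S) \<in> P. \<not> b f}"
    using assms by (auto intro: finite_subset)
  then show ?thesis
    unfolding proj_def by auto
qed

text \<open>\<open>\<S>\<close> is \<open>idx\<close> for the chain condition and the collection of
  finite sets for formulas, where the new conditions must again be expressible by the
  predicates.\<close>

lemma proj_lin:
  assumes "elim C V y b g" "P \<subseteq> lin C V \<times> \<S>" "\<And>S T. S \<in> \<S> \<Longrightarrow> T \<in> \<S> \<Longrightarrow> S \<union> T \<in> \<S>"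
  shows "proj b g P \<subseteq> lin C (V - {y}) \<times> \<S>"
proof -
  have *: "g f \<in> lin C (V - {y}) \<and> S \<in> \<S>" if "(f, S) \<in> P" for f S
    using bspec[OF assms(1)[unfolded elim_def], of f] assms(2) that by auto
  show ?thesis
  proof
    fix q
    assume "q \<in> proj b g P"
    then consider f S where "(f, S) \<in> P" "q = (g f, S)"
      | f S f' S' where "(f, S) \<in> P" "(f', S') \<in> P" "q = (\<lambda>e. g f e \<otimes> inv (g f' e), S \<union> S')"
      unfolding proj_def by auto
    then show "q \<in> lin C (V - {y}) \<times> \<S>"
    proof cases
      case 1
      then show ?thesis
        using * by blast
    next
      case 2
      then show ?thesis
        using *[OF 2(1)] *[OF 2(2)] assms(3) by (simp add: lin_mult lin_inv)
    qed
  qed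
qed

lemma proj_memI1: "(f, S) \<in> P \<Longrightarrow> \<not> b f \<Longrightarrow> (g f, S) \<in> proj b g P"
  unfolding proj_def by (rule UnI1, rule image_eqI[of _ _ "(f, S)"]) auto

lemma proj_memI2:
  "(f, S) \<in> P \<Longrightarrow> (f', S') \<in> P \<Longrightarrow> b f \<Longrightarrow> b f' \<Longrightarrow>
    (\<lambda>e. g f e \<otimes> inv (g f' e), S \<union> S') \<in> proj b g P"
  unfolding proj_def by (rule UnI2, rule image_eqI[of _ _ "((f, S), (f', S'))"]) auto

lemma elim_upd:
  assumes "elim C V y b g" "f \<in> lin C V"
  shows "f (e(y := a)) \<in> K S \<longleftrightarrow> (if b f then cg S a (g f e) else g f e \<in> K S)"
proof -
  note elim = bspec[OF assms(1)[unfolded elim_def] assms(2)]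
  have "g f (e(y := a)) = g f e"
    by (rule lin_cong[OF conjunct1[OF elim]]) auto
  then show ?thesis
    using spec[OF spec[OF conjunct2[OF elim], of "e(y := a)"], of S] by simp
qed

text \<open>Agreement on the pair conditions is exactly the hypothesis of
  \<open>back_and_forth\<close> for the congruences on the variable \<open>y\<close>.\<close>

lemma proj_agree:
  assumes b: "elim C V y b g" and P: "finite P" "P \<subseteq> lin C V \<times> idx"
    and e: "agree (proj b g P) e e'"
  shows "\<exists>a'. agree P (e(y := a)) (e'(y := a'))"
proof -
  let ?N = "{p \<in> P. b (fst p)}"
  have "\<exists>a'. \<forall>p\<in>?N. cg (snd p) a (g (fst p) e) \<longleftrightarrow> cg (snd p) a' (g (fst p) e')"
  proof (rule back_and_forth)
    fix p q
    assume "p \<in> ?N" "q \<in> ?N"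
    then have "(\<lambda>e. g (fst p) e \<otimes> inv (g (fst q) e), snd p \<union> snd q) \<in> proj b g P"
      by (intro proj_memI2) auto
    then show "cg (snd p \<union> snd q) (g (fst p) e) (g (fst q) e) \<longleftrightarrow>
        cg (snd p \<union> snd q) (g (fst p) e') (g (fst q) e')"
      using e unfolding agree_def cg_def by auto
  qed (use P in auto)
  then obtain a' where
    a': "\<And>p. p \<in> ?N \<Longrightarrow> cg (snd p) a (g (fst p) e) \<longleftrightarrow> cg (snd p) a' (g (fst p) e')"
    by blast
  have "f (e(y := a)) \<in> K S \<longleftrightarrow> f (e'(y := a')) \<in> K S" if fS: "(f, S) \<in> P" for f S
  proof -
    have f: "f \<in> lin C V"
      using P fS by auto
    show ?thesis
    proof (cases "b f")
      case True
      then show ?thesis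
        using a'[of "(f, S)"] fS by (simp add: elim_upd[OF b f])
    next
      case False
      then have "(g f, S) \<in> proj b g P"
        using fS proj_memI1 by blast
      then show ?thesis
        using False e by (auto simp: elim_upd[OF b f] agree_def)
    qed
  qed
  then show ?thesis
    unfolding agree_def by blast
qed

text \<open>For pure conjunctions the projection is described exactly: compatibility of the pairs is
  necessary by transitivity and sufficient by \<open>chinese_remainder\<close>.\<close>

lemma sol_proj:
  assumes b: "elim C V y b g" and P: "finite P" "P \<subseteq> lin C V \<times> idx"
  shows "(\<exists>a. e(y := a) \<in> sol P) \<longleftrightarrow> e \<in> sol (proj b g P)"
proof
  have upd: "f (e(y := a)) \<in> K S \<longleftrightarrow> (if b f then cg S a (g f e) else g f e \<in> K S)"
    if "(f, S) \<in> P" for f S a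
    using P that by (intro elim_upd[OF b]) auto
  {
    assume "\<exists>a. e(y := a) \<in> sol P"
    then obtain a where a: "\<And>f S. (f, S) \<in> P \<Longrightarrow> if b f then cg S a (g f e) else g f e \<in> K S"
      using upd unfolding sol_def by blast
    have "cg (S \<union> S') (g f e) (g f' e)"
      if "(f, S) \<in> P" "(f', S') \<in> P" "b f" "b f'" for f S f' S'
    proof -
      have "S \<in> idx" "S' \<in> idx"
        using that P by auto
      then have "cg (S \<union> S') (g f e) a" "cg (S \<union> S') a (g f' e)"
        using a[OF that(1)] a[OF that(2)] that cg_sym by (auto intro: cg_UnI1 cg_UnI2)
      then show ?thesis
        by (rule cg_trans)
    qed
    moreover have "g f e \<in> K S" if "(f, S) \<in> P" "\<not> b f" for f S
      using a[OF that(1)] that(2) by simp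
    ultimately show "e \<in> sol (proj b g P)"
      unfolding sol_def proj_def cg_def by auto
  next
    assume e: "e \<in> sol (proj b g P)"
    have "\<exists>a. \<forall>(r, S)\<in>(\<lambda>(f, S). (g f e, S)) ` {(f, S) \<in> P. b f}. cg S a r"
    proof (rule chinese_remainder)
      fix r S r' S'
      assume "(r, S) \<in> (\<lambda>(f, S). (g f e, S)) ` {(f, S) \<in> P. b f}"
        "(r', S') \<in> (\<lambda>(f, S). (g f e, S)) ` {(f, S) \<in> P. b f}"
      then obtain f f' where "(f, S) \<in> P" "b f" "r = g f e" "(f', S') \<in> P" "b f'" "r' = g f' e"
        by auto
      then show "cg (S \<union> S') r r'"
        using e proj_memI2[of f S P f' S' b g] unfolding sol_def cg_def by auto
    next
      show "finite ((\<lambda>(f, S). (g f e, S)) ` {(f, S) \<in> P. b f})"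
        by (rule finite_imageI, rule finite_subset[OF _ P(1)]) auto
    qed (use P in auto)
    then obtain a where "\<forall>(r, S)\<in>(\<lambda>(f, S). (g f e, S)) ` {(f, S) \<in> P. b f}. cg S a r"
      by blast
    then have a: "cg S a (g f e)" if "(f, S) \<in> P" "b f" for f S
      using that by auto
    have "g f e \<in> K S" if "(f, S) \<in> P" "\<not> b f" for f S
      using e proj_memI1[of f S P b g] that unfolding sol_def by auto
    then have "e(y := a) \<in> sol P"
      using a upd unfolding sol_def by auto
    then show "\<exists>a. e(y := a) \<in> sol P" ..
  }
qed

section \<open>The descending chain condition\<close>

lemma antimono_idx_stable:
  assumes "\<And>j. T j \<in> idx" "\<And>j. T (Suc j) \<subseteq> T j"
  shows "\<exists>j. \<forall>k\<ge>j. T k = T j"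
proof (cases "\<forall>j. T j = UNIV")
  case False
  then obtain i where "finite (T i)"
    using assms(1) by (auto simp: idx_def)
  define j where "j = (ARG_MIN (\<lambda>j. card (T j)) j. j \<ge> i)"
  have j: "j \<ge> i" "\<And>k. k \<ge> i \<Longrightarrow> card (T j) \<le> card (T k)"
    using arg_min_nat_lemma[of "\<lambda>j. j \<ge> i" i "\<lambda>j. card (T j)"] unfolding j_def by auto
  have anti: "T l \<subseteq> T k" if "k \<le> l" for k l
    using lift_Suc_antimono_le[of T] assms(2) that by blast
  have "T k = T j" if "k \<ge> j" for k
  proof (rule card_seteq)
    show "finite (T j)"
      using \<open>finite (T i)\<close> anti[of i j] j(1) finite_subset by blast
  qed (use that anti j in auto)
  then show ?thesis
    by blast
qed simp

text \<open>
  For a chain of conjunctions in one more variable, both the projections and the fibres stabilize;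
  the fibres are classes of congruences that do not depend on the point below.
\<close>

lemma sol_chain_stable:
  assumes "\<And>j. finite (P j)" "\<And>j. P j \<subseteq> lin UNIV {..<n} \<times> idx" "\<And>j. P j \<subseteq> P (Suc j)"
  shows "\<exists>j. \<forall>k\<ge>j. sol (P k) = sol (P j)"
  using assms
proof (induction n arbitrary: P)
  case 0
  have const: "f e = f e'" if "(f, S) \<in> P j" for f S j e e'
    using lin_cong[of f UNIV "{}"] 0(2)[of j] that by auto
  have anti: "sol (P k) \<subseteq> sol (P j)" if "j \<le> k" for j k
    using lift_Suc_mono_le[of P, OF 0(3) that] unfolding sol_def by auto
  show ?case
  proof (cases "\<exists>j. sol (P j) = {}")
    case True
    then show ?thesis
      using anti by blast
  next
    case False
    have "sol (P j) = UNIV" for j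
    proof -
      obtain e where e: "e \<in> sol (P j)"
        using False by blast
      have "e' \<in> sol (P j)" for e'
        unfolding sol_def
      proof safe
        fix f S
        assume fS: "(f, S) \<in> P j"
        then show "f e' \<in> K S"
          using e const[OF fS, of e e'] unfolding sol_def by auto
      qed
      then show ?thesis
        by blast
    qed
    then show ?thesis
      by blast
  qed
next
  case (Suc n)
  have P_mono: "P j \<subseteq> P k" if "j \<le> k" for j k
    using lift_Suc_mono_le[of P, OF Suc.prems(3) that] .
  obtain b g where b: "elim UNIV {..<Suc n} n b g"
    using ex_elim by blast
  define T where "T j = \<Inter>(snd ` {(f, S) \<in> P j. b f})" for j
  have fin: "finite {(f, S) \<in> P j. b f}" for j
    using Suc.prems(1)[of j] by (rule finite_subset[rotated]) auto
  have "T j \<in> idx" for j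
    using fin[of j] Suc.prems(2)[of j] unfolding T_def by (intro idx_Inter) auto
  moreover have "T (Suc j) \<subseteq> T j" for j
    using Suc.prems(3)[of j] unfolding T_def by (intro Inter_anti_mono image_mono) auto
  ultimately obtain j1 where j1: "\<And>k. k \<ge> j1 \<Longrightarrow> T k = T j1"
    using antimono_idx_stable[of T] by blast
  have "\<exists>j. \<forall>k\<ge>j. sol (proj b g (P k)) = sol (proj b g (P j))"
  proof (rule Suc.IH)
    show "proj b g (P j) \<subseteq> lin UNIV {..<n} \<times> idx" for j
    proof -
      have "{..<Suc n} - {n} = {..<n}"
        by auto
      then show ?thesis
        using proj_lin[OF b Suc.prems(2), of j] by simp
    qed
  qed (rule proj_finite[OF Suc.prems(1)], rule proj_mono[OF Suc.prems(3)])
  then obtain j2 where j2: "\<And>k. k \<ge> j2 \<Longrightarrow> sol (proj b g (P k)) = sol (proj b g (P j2))"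
    by blast
  define j where "j = max j1 j2"
  \<comment> \<open>The projections coincide, so some value \<open>a\<close> of coordinate
    \<open>n\<close> over the same point satisfies \<open>P k\<close>, hence also
    \<open>P j\<close>. Both \<open>a\<close> and \<open>e n\<close> then lie in one class modulo
    \<open>T j = T k\<close>, which carries the congruences of \<open>P k\<close> over to
    \<open>e n\<close>.\<close>
  have "sol (P j) \<subseteq> sol (P k)" if "k \<ge> j" for k
  proof
    fix e
    assume e: "e \<in> sol (P j)"
    then have "e(n := e n) \<in> sol (P j)"
      by simp
    then have "e \<in> sol (proj b g (P j))"
      using sol_proj[OF b Suc.prems(1,2)] by blast
    then have "e \<in> sol (proj b g (P k))"
      using j2[of j] j2[of k] that by (simp add: j_def)
    then obtain a where a: "e(n := a) \<in> sol (P k)"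
      using sol_proj[OF b Suc.prems(1,2)] by blast
    have upd: "f (e(n := a)) \<in> K S \<longleftrightarrow> (if b f then cg S a (g f e) else g f e \<in> K S)"
      if "(f, S) \<in> P k" for f S a k
      using Suc.prems(2)[of k] that by (intro elim_upd[OF b]) auto
    have "cg S a (e n)" if "(f, S) \<in> P j" "b f" for f S
    proof -
      have "(f, S) \<in> P k"
        using that P_mono[OF \<open>k \<ge> j\<close>] by blast
      then have "cg S a (g f e)" "cg S (e n) (g f e)"
        using a e upd[of f S k a] upd[of f S j "e n"] that unfolding sol_def by auto
      then show ?thesis
        using cg_sym cg_trans by blast
    qed
    then have "cg (T j) a (e n)"
      using fin[of j] Suc.prems(2)[of j] unfolding T_def by (subst cg_Inter) auto
    then have Tk: "cg (T k) a (e n)"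
      using j1[of j] j1[of k] that by (simp add: j_def)
    have "f e \<in> K S" if fS: "(f, S) \<in> P k" for f S
    proof -
      have "cg S (e n) (g f e)" if "b f"
      proof -
        have "cg S a (e n)"
          using Tk fin[of k] Suc.prems(2)[of k] fS that unfolding T_def
          by (subst (asm) cg_Inter) auto
        moreover have "cg S a (g f e)"
          using a upd[OF fS, of a] fS that unfolding sol_def by auto
        ultimately show ?thesis
          using cg_sym cg_trans by blast
      qed
      moreover have "g f e \<in> K S" if "\<not> b f"
        using a upd[OF fS, of a] fS that unfolding sol_def by auto
      ultimately show ?thesis
        using upd[OF fS, of "e n"] by auto
    qed
    then show "e \<in> sol (P k)"
      unfolding sol_def by auto
  qed
  moreover have "sol (P k) \<subseteq> sol (P j)" if "k \<ge> j" for k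
    using P_mono[OF that] unfolding sol_def by auto
  ultimately show ?case
    by blast
qed

end

section \<open>Models of the theory of \<open>G_struct\<close>\<close>

abbreviation All :: "nat \<Rightarrow> 'i fm \<Rightarrow> 'i fm" where
  "All i \<phi> \<equiv> Neg (Exi i (Neg \<phi>))"

abbreviation Imp :: "'i fm \<Rightarrow> 'i fm \<Rightarrow> 'i fm" where
  "Imp \<phi> \<psi> \<equiv> Neg (Conj \<phi> (Neg \<psi>))"

abbreviation Diff :: "trm \<Rightarrow> trm \<Rightarrow> trm" where
  "Diff s t \<equiv> Plus s (Minus t)"

primrec mult_trm :: "nat \<Rightarrow> trm \<Rightarrow> trm" where
  "mult_trm 0 t = Zero"
| "mult_trm (Suc n) t = Plus (mult_trm n t) t"

lemma fvt_mult_trm: "fvt (mult_trm n t) \<subseteq> fvt t"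
  by (induction n) auto

lemma eval_trm_cong: "(\<And>i. i \<in> fvt t \<Longrightarrow> e i = e' i) \<Longrightarrow> eval_trm M e t = eval_trm M e' t"
  by (induction t) simp_all

definition group_of :: "('i, 'a) lstructure \<Rightarrow> 'a monoid" where
  "group_of M = \<lparr>carrier = UNIV, monoid.mult = plus_of M, one = zero_of M\<rparr>"

text \<open>Infinite index sets are sent to the whole group; the only one of them in
  \<open>idx\<close> is \<open>UNIV\<close>.\<close>

definition sub_of :: "(nat fset, 'a) lstructure \<Rightarrow> nat set \<Rightarrow> 'a set" where
  "sub_of M S = (if finite S then pred_of M (Abs_fset S) else UNIV)"

lemma sub_of_fset [simp]: "sub_of M (fset I) = pred_of M I"
  by (simp add: sub_of_def fset_inverse)

lemma sub_of_UNIV [simp]: "sub_of M UNIV = UNIV"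
  by (simp add: sub_of_def)

lemma G_struct_simps [simp]:
  "zero_of G_struct = 0" "plus_of G_struct = (+)" "minus_of G_struct = uminus" "pred_of G_struct = H"
  by (simp_all add: G_struct_def)

lemma H_iff: "g \<in> H I \<longleftrightarrow> (\<forall>i. i |\<notin>| I \<longrightarrow> Poly_Mapping.lookup g i = 0)"
  by (simp add: H_def)

lemma lookup_mult_trm:
  "Poly_Mapping.lookup (eval_trm G_struct e (mult_trm n t)) i =
    of_nat n * Poly_Mapping.lookup (eval_trm G_struct e t) i"
  by (induction n) (simp_all add: lookup_add algebra_simps)

text \<open>Every coordinate is divided by \<open>n\<close>; here the summands have to be
  divisible.\<close>

lemma G_divisible: "0 < n \<Longrightarrow> \<exists>y. eval_trm G_struct (e(j := y)) (mult_trm n (Var j)) = x"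
proof (intro exI poly_mapping_eqI)
  fix i
  assume "0 < n"
  then show "Poly_Mapping.lookup (eval_trm G_struct (e(j := Poly_Mapping.map (\<lambda>q. q / of_nat n) x))
      (mult_trm n (Var j))) i = Poly_Mapping.lookup x i"
    by (simp add: lookup_mult_trm Poly_Mapping.map.rep_eq when_def)
qed

lemma H_Un: "g \<in> H (I |\<union>| J) \<Longrightarrow> \<exists>h. h \<in> H I \<and> g + (- h) \<in> H J"
proof -
  assume g: "g \<in> H (I |\<union>| J)"
  \<comment> \<open>\<open>h\<close> keeps the coordinates of \<open>g\<close> inside
    \<open>I\<close> and kills the others.\<close>
  define h where "h = Abs_poly_mapping (\<lambda>i. Poly_Mapping.lookup g i when i |\<in>| I)"
  have "finite {i. (Poly_Mapping.lookup g i when i |\<in>| I) \<noteq> 0}"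
    by (rule finite_subset[OF _ finite_lookup[of g]]) (auto simp: when_def)
  then have "Poly_Mapping.lookup h i = (Poly_Mapping.lookup g i when i |\<in>| I)" for i
    unfolding h_def by (simp add: lookup_Abs_poly_mapping)
  then show ?thesis
    using g by (intro exI[of _ h]) (auto simp: H_iff lookup_minus when_def)
qed

lemma H_not_subset: "\<not> fset I \<subseteq> fset J \<Longrightarrow> \<exists>g. g \<in> H I \<and> g \<notin> H J"
proof -
  assume "\<not> fset I \<subseteq> fset J"
  then obtain i where "i |\<in>| I" "i |\<notin>| J"
    by auto
  then show ?thesis
    by (intro exI[of _ "Poly_Mapping.single i 1"]) (auto simp: H_iff lookup_single when_def)
qed

lemma sat_AllD: "sat M e (All i \<phi>) \<Longrightarrow> sat M (e(i := a)) \<phi>"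
  by auto

locale G_model =
  fixes M :: "(nat fset, 'a) lstructure"
  assumes elem_equiv: "elem_equiv M G_struct"
begin

text \<open>The route by which the facts below reach \<open>M\<close>: for fixed index sets and a
  fixed multiplier each is one sentence, checked by coordinates in \<open>G_struct\<close>.\<close>

lemma transfer: "(\<And>e. sat G_struct e \<sigma>) \<Longrightarrow> fv \<sigma> = {} \<Longrightarrow> sat M e \<sigma>"
  using elem_equiv unfolding elem_equiv_def by blast

lemma plus_assoc: "plus_of M (plus_of M x y) z = plus_of M x (plus_of M y z)"
proof -
  have "sat M (\<lambda>_. undefined) (All 0 (All 1 (All 2 (Eq (Plus (Plus (Var 0) (Var 1)) (Var 2))
    (Plus (Var 0) (Plus (Var 1) (Var 2)))))))"
    by (rule transfer) (auto simp: add.assoc)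
  then show ?thesis
    by simp
qed

lemma plus_commute: "plus_of M x y = plus_of M y x"
proof -
  have "sat M (\<lambda>_. undefined) (All 0 (All 1 (Eq (Plus (Var 0) (Var 1)) (Plus (Var 1) (Var 0)))))"
    by (rule transfer) (auto simp: add.commute)
  then show ?thesis
    by simp
qed

lemma plus_zero: "plus_of M (zero_of M) x = x"
proof -
  have "sat M (\<lambda>_. undefined) (All 0 (Eq (Plus Zero (Var 0)) (Var 0)))"
    by (rule transfer) auto
  then show ?thesis
    by simp
qed

lemma plus_minus: "plus_of M (minus_of M x) x = zero_of M"
proof -
  have "sat M (\<lambda>_. undefined) (All 0 (Eq (Plus (Minus (Var 0)) (Var 0)) Zero))"
    by (rule transfer) auto
  then show ?thesis
    by simp
qed

lemma pred_zero: "zero_of M \<in> pred_of M I"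
proof -
  have "sat M (\<lambda>_. undefined) (Mem I Zero)"
    by (rule transfer) (auto simp: H_iff)
  then show ?thesis
    by simp
qed

lemma pred_plus:
  assumes "x \<in> pred_of M I" "y \<in> pred_of M I"
  shows "plus_of M x y \<in> pred_of M I"
proof -
  have "sat M (\<lambda>_. undefined) (All 0 (All 1 (Imp (Conj (Mem I (Var 0)) (Mem I (Var 1)))
    (Mem I (Plus (Var 0) (Var 1))))))"
    by (rule transfer) (auto simp: H_iff lookup_add, metis add.left_neutral)
  then show ?thesis
    using assms by simp
qed

lemma pred_minus:
  assumes "x \<in> pred_of M I"
  shows "minus_of M x \<in> pred_of M I"
proof -
  have "sat M (\<lambda>_. undefined) (All 0 (Imp (Mem I (Var 0)) (Mem I (Minus (Var 0)))))"
    by (rule transfer) (auto simp: H_iff)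
  then show ?thesis
    using assms by simp
qed

lemma pred_empty:
  assumes "x \<in> pred_of M {||}"
  shows "x = zero_of M"
proof -
  have "sat M (\<lambda>_. undefined) (All 0 (Imp (Mem {||} (Var 0)) (Eq (Var 0) Zero)))"
    by (rule transfer) (auto simp: H_iff poly_mapping_eq_iff fun_eq_iff)
  then show ?thesis
    using assms by simp
qed

lemma pred_mono:
  assumes "I |\<subseteq>| J" "x \<in> pred_of M I"
  shows "x \<in> pred_of M J"
proof -
  have "sat M (\<lambda>_. undefined) (All 0 (Imp (Mem I (Var 0)) (Mem J (Var 0))))"
    by (rule transfer) (use assms(1) in \<open>auto simp: H_iff\<close>)
  then show ?thesis
    using assms by simp
qed

lemma pred_Int:
  assumes "x \<in> pred_of M I" "x \<in> pred_of M J"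
  shows "x \<in> pred_of M (I |\<inter>| J)"
proof -
  have "sat M (\<lambda>_. undefined) (All 0 (Imp (Conj (Mem I (Var 0)) (Mem J (Var 0))) (Mem (I |\<inter>| J) (Var 0))))"
    by (rule transfer) (auto simp: H_iff)
  then show ?thesis
    using assms by simp
qed

lemma pred_Un:
  assumes "x \<in> pred_of M (I |\<union>| J)"
  shows "\<exists>y. y \<in> pred_of M I \<and> plus_of M x (minus_of M y) \<in> pred_of M J"
proof -
  have "sat M (\<lambda>_. undefined) (All 0 (Imp (Mem (I |\<union>| J) (Var 0))
    (Exi 1 (Conj (Mem I (Var 1)) (Mem J (Diff (Var 0) (Var 1)))))))"
    by (rule transfer) (auto dest!: H_Un)
  then show ?thesis
    using assms by simp
qed

lemma pred_not_subset:
  assumes "\<not> fset I \<subseteq> fset J"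
  shows "\<exists>x. x \<in> pred_of M I \<and> x \<notin> pred_of M J"
proof -
  have "sat M (\<lambda>_. undefined) (Exi 0 (Conj (Mem I (Var 0)) (Neg (Mem J (Var 0)))))"
    by (rule transfer) (use H_not_subset[OF assms(1)] in auto)
  then show ?thesis
    by simp
qed

lemma pred_pure:
  "0 < n \<Longrightarrow> eval_trm M (\<lambda>_. x) (mult_trm n (Var 0)) \<in> pred_of M I \<Longrightarrow> x \<in> pred_of M I"
proof -
  assume n: "0 < n" "eval_trm M (\<lambda>_. x) (mult_trm n (Var 0)) \<in> pred_of M I"
  have "sat M (\<lambda>_. x) (All 0 (Imp (Mem I (mult_trm n (Var 0))) (Mem I (Var 0))))"
    using n(1) fvt_mult_trm[of n "Var 0"] by (intro transfer) (auto simp: H_iff lookup_mult_trm)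
  from sat_AllD[OF this, of x] show ?thesis
    using n(2) by (simp add: fun_upd_idem)
qed

lemma plus_divisible: "0 < n \<Longrightarrow> \<exists>y. eval_trm M (\<lambda>_. y) (mult_trm n (Var 1)) = x"
proof -
  assume n: "0 < n"
  have "sat M (\<lambda>_. x) (All 0 (Exi 1 (Eq (mult_trm n (Var 1)) (Var 0))))"
    using fvt_mult_trm[of n "Var 1"] G_divisible[OF n, of _ 1] by (intro transfer) auto
  from sat_AllD[OF this, of x] obtain y where "eval_trm M ((\<lambda>_. x)(1 := y)) (mult_trm n (Var 1)) = x"
    by (auto simp: fun_upd_idem)
  moreover have "eval_trm M ((\<lambda>_. x)(1 := y)) (mult_trm n (Var 1)) = eval_trm M (\<lambda>_. y) (mult_trm n (Var 1))"
    using fvt_mult_trm[of n "Var 1"] by (intro eval_trm_cong) auto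
  ultimately show ?thesis
    by auto
qed

lemma comm_group_of: "comm_group (group_of M)"
proof (rule comm_groupI)
  show "\<exists>y\<in>carrier (group_of M). y \<otimes>\<^bsub>group_of M\<^esub> x = \<one>\<^bsub>group_of M\<^esub>" for x
    using plus_minus by (auto simp: group_of_def)
  show "x \<otimes>\<^bsub>group_of M\<^esub> y = y \<otimes>\<^bsub>group_of M\<^esub> x" for x y
    using plus_commute by (simp add: group_of_def)
qed (simp_all add: group_of_def plus_assoc plus_zero)

interpretation grp: comm_group "group_of M"
  by (rule comm_group_of)

lemma inv_group_of: "inv\<^bsub>group_of M\<^esub> x = minus_of M x"
proof (rule grp.inv_equality)
  show "minus_of M x \<otimes>\<^bsub>group_of M\<^esub> x = \<one>\<^bsub>group_of M\<^esub>"
    by (simp add: group_of_def plus_minus)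
qed (simp_all add: group_of_def)

lemma eval_mult_trm: "eval_trm M e (mult_trm n t) = eval_trm M e t [^]\<^bsub>group_of M\<^esub> n"
  by (induction n) (simp_all add: group_of_def)

lemma sub_of_pred:
  assumes "finite S"
  obtains I where "S = fset I" "sub_of M S = pred_of M I"
  using assms by (metis Abs_fset_inverse mem_Collect_eq sub_of_fset)

sublocale subgroup_family "group_of M" "sub_of M"
proof (intro subgroup_family.intro comm_group_of subgroup_family_axioms.intro)
  show "carrier (group_of M) = UNIV"
    by (simp add: group_of_def)
  show "subgroup (sub_of M S) (group_of M)" for S
  proof (cases "finite S")
    case True
    then obtain I where "sub_of M S = pred_of M I"
      by (rule sub_of_pred)
    then show ?thesis
      unfolding subgroup_def inv_group_of
      by (simp add: group_of_def pred_zero pred_plus pred_minus)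
  next
    case False
    then show ?thesis
      by (simp add: sub_of_def group_of_def subgroup_def)
  qed
  show "sub_of M UNIV = UNIV"
    by simp
  show "sub_of M {} = {\<one>\<^bsub>group_of M\<^esub>}"
    using sub_of_fset[of M "{||}"] pred_empty pred_zero by (auto simp: group_of_def)
  show "sub_of M (S \<inter> T) = sub_of M S \<inter> sub_of M T" if "S \<in> idx" "T \<in> idx" for S T
  proof (cases "finite S \<and> finite T")
    case True
    then obtain I J where "S = fset I" "T = fset J"
      using sub_of_pred by metis
    then show ?thesis
      using sub_of_fset[of M "I |\<inter>| J"] pred_mono[of "I |\<inter>| J"] pred_Int[of _ I J]
      by (auto simp: inter_fset)
  qed (use that in \<open>auto simp: idx_def\<close>)
  show "\<exists>y\<in>sub_of M S. x \<otimes>\<^bsub>group_of M\<^esub> inv\<^bsub>group_of M\<^esub> y \<in> sub_of M T"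
    if "S \<in> idx" "T \<in> idx" "x \<in> sub_of M (S \<union> T)" for S T x
  proof (cases "finite S \<and> finite T")
    case True
    then obtain I J where IJ: "S = fset I" "T = fset J"
      using sub_of_pred by metis
    then have "x \<in> pred_of M (I |\<union>| J)"
      using that(3) sub_of_fset[of M "I |\<union>| J"] by (simp add: union_fset)
    then obtain y where "y \<in> pred_of M I" "plus_of M x (minus_of M y) \<in> pred_of M J"
      using pred_Un by blast
    then show ?thesis
      unfolding inv_group_of IJ by (intro bexI[of _ y]) (simp_all add: group_of_def)
  next
    case False
    then have "S = UNIV \<or> T = UNIV"
      using that(1,2) by (auto simp: idx_def)
    then show ?thesis
    proof
      assume "S = UNIV"
      have "x \<otimes>\<^bsub>group_of M\<^esub> inv\<^bsub>group_of M\<^esub> x \<in> sub_of M T"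
        using \<open>subgroup (sub_of M T) (group_of M)\<close>
        by (metis UNIV_I \<open>carrier (group_of M) = UNIV\<close> grp.r_inv subgroup.one_closed)
      then show ?thesis
        using \<open>S = UNIV\<close> by auto
    next
      assume "T = UNIV"
      then show ?thesis
        using subgroup.one_closed[OF \<open>subgroup (sub_of M S) (group_of M)\<close>] by auto
    qed
  qed
  show "S \<subseteq> T" if "S \<in> idx" "T \<in> idx" "sub_of M S \<subseteq> sub_of M T" for S T
  proof (rule ccontr)
    assume *: "\<not> S \<subseteq> T"
    then have "T \<noteq> UNIV"
      by auto
    then have "finite T"
      using that by (simp add: idx_def)
    \<comment> \<open>\<open>S\<close> may be \<open>UNIV\<close>, which no predicate names, so the
      separating element is sought in the subgroup of a single index of \<open>S\<close>.\<close>
    then obtain i where i: "i \<in> S" "i \<notin> T"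
      using * by auto
    obtain J where J: "T = fset J"
      using \<open>finite T\<close> sub_of_pred by metis
    obtain x where x: "x \<in> pred_of M {|i|}" "x \<notin> pred_of M J"
      using pred_not_subset[of "{|i|}" J] i J by auto
    have "x \<in> sub_of M S"
    proof (cases "finite S")
      case True
      then obtain I where "S = fset I"
        using sub_of_pred by metis
      then show ?thesis
        using i(1) x(1) pred_mono[of "{|i|}" I] by auto
    next
      case False
      then show ?thesis
        by (simp add: sub_of_def)
    qed
    then show False
      using that(3) x(2) J by auto
  qed
  show "x \<in> sub_of M S" if "0 < n" "x [^]\<^bsub>group_of M\<^esub> n \<in> sub_of M S" for n :: nat and x S
  proof (cases "finite S")
    case True
    then obtain I where "sub_of M S = pred_of M I"
      by (rule sub_of_pred)
    then show ?thesis
      using that pred_pure[of n x I] by (simp add: eval_mult_trm)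
  next
    case False
    then show ?thesis
      by (simp add: sub_of_def)
  qed
  show "\<exists>y. y [^]\<^bsub>group_of M\<^esub> n = x" if "0 < n" for n :: nat and x
    using plus_divisible[OF that, of x] by (simp add: eval_mult_trm)
qed

end

section \<open>Elimination of quantifiers\<close>

context G_model
begin

lemma plus_of_eq: "plus_of M x y = x \<otimes>\<^bsub>group_of M\<^esub> y"
  and zero_of_eq: "zero_of M = \<one>\<^bsub>group_of M\<^esub>"
  and minus_of_eq: "minus_of M x = inv\<^bsub>group_of M\<^esub> x"
  unfolding inv_group_of by (simp_all add: group_of_def)

lemma lin_eval_trm: "(\<lambda>e. eval_trm M e t) \<in> lin C (fvt t)"
proof (induction t)
  case (Plus s t)
  then show ?case
    by (auto simp: plus_of_eq intro!: lin_mult intro: lin_mono)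
qed (auto simp: zero_of_eq minus_of_eq intro: lin.intros)

definition int_mult_trm :: "int \<Rightarrow> trm \<Rightarrow> trm" where
  "int_mult_trm z t = (if z < 0 then Minus (mult_trm (nat (- z)) t) else mult_trm (nat z) t)"

lemma fvt_int_mult_trm: "fvt (int_mult_trm z t) \<subseteq> fvt t"
  using fvt_mult_trm by (auto simp: int_mult_trm_def)

lemma eval_int_mult_trm: "eval_trm M e (int_mult_trm z t) = eval_trm M e t [^]\<^bsub>group_of M\<^esub> z"
  unfolding int_mult_trm_def int_pow_def2 by (simp add: eval_mult_trm minus_of_eq)

text \<open>Terms have integer coefficients only, so a rational form is reached up to a nonzero
  multiple; by purity the multiple defines the same conditions.\<close>

lemma lin_multiple_is_trm:
  assumes "f \<in> lin {} V"
  shows "\<exists>n t. n \<noteq> 0 \<and> fvt t \<subseteq> V \<and> (\<forall>e. f e [^]\<^bsub>group_of M\<^esub> (n :: int) = eval_trm M e t)"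
  using assms
proof (induction f rule: lin.induct)
  case (lin_var i)
  then show ?case
    by (intro exI[of _ 1] exI[of _ "Var i"]) auto
next
  case lin_one
  then show ?case
    by (intro exI[of _ 1] exI[of _ Zero]) (auto simp: zero_of_eq)
next
  case (lin_mult f f')
  from lin_mult.IH(1) obtain n :: int and t where
    t: "n \<noteq> 0" "fvt t \<subseteq> V" "\<forall>e. f e [^]\<^bsub>group_of M\<^esub> n = eval_trm M e t"
    by blast
  from lin_mult.IH(2) obtain n' :: int and t' where
    t': "n' \<noteq> 0" "fvt t' \<subseteq> V" "\<forall>e. f' e [^]\<^bsub>group_of M\<^esub> n' = eval_trm M e t'"
    by blast
  have "(f e \<otimes>\<^bsub>group_of M\<^esub> f' e) [^]\<^bsub>group_of M\<^esub> (n * n') =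
      eval_trm M e (Plus (int_mult_trm n' t) (int_mult_trm n t'))" for e
  proof -
    have "(f e \<otimes>\<^bsub>group_of M\<^esub> f' e) [^]\<^bsub>group_of M\<^esub> (n * n') =
        (f e [^]\<^bsub>group_of M\<^esub> n) [^]\<^bsub>group_of M\<^esub> n' \<otimes>\<^bsub>group_of M\<^esub>
        (f' e [^]\<^bsub>group_of M\<^esub> n') [^]\<^bsub>group_of M\<^esub> n"
      by (simp add: int_pow_distrib int_pow_pow mult.commute)
    then show ?thesis
      using t(3) t'(3) by (simp add: plus_of_eq eval_int_mult_trm)
  qed
  moreover have "fvt (Plus (int_mult_trm n' t) (int_mult_trm n t')) \<subseteq> V"
    using t(2) t'(2) fvt_int_mult_trm[of n' t] fvt_int_mult_trm[of n t'] by auto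
  ultimately show ?case
    using t(1) t'(1) by (intro exI[of _ "n * n'"] exI[of _ "Plus (int_mult_trm n' t) (int_mult_trm n t')"]) simp
next
  case (lin_inv f)
  then obtain n :: int and t where
    t: "n \<noteq> 0" "fvt t \<subseteq> V" "\<forall>e. f e [^]\<^bsub>group_of M\<^esub> n = eval_trm M e t"
    by blast
  then show ?case
    by (intro exI[of _ n] exI[of _ "Minus t"]) (simp add: int_pow_inv minus_of_eq)
next
  case (lin_root f m g)
  then obtain n :: int and t where
    t: "n \<noteq> 0" "fvt t \<subseteq> V" "\<forall>e. f e [^]\<^bsub>group_of M\<^esub> n = eval_trm M e t"
    by blast
  have "g e [^]\<^bsub>group_of M\<^esub> (m * n) = eval_trm M e t" for e
    using lin_root.hyps(3)[of e] t(3) by (simp flip: int_pow_pow)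
  then show ?case
    using t lin_root.hyps(2) by (intro exI[of _ "m * n"] exI[of _ t]) auto
qed auto

lemma lin_is_trm:
  assumes "f \<in> lin {} V"
  shows "\<exists>t. fvt t \<subseteq> V \<and> (\<forall>e S. f e \<in> sub_of M S \<longleftrightarrow> eval_trm M e t \<in> sub_of M S)"
  using lin_multiple_is_trm[OF assms] K_int_pow_iff by metis

text \<open>Quantifier elimination without constructing a quantifier-free formula: equations are
  memberships in the trivial subgroup, a conjunction takes the union of the supports, and a
  quantifier takes \<open>proj\<close>.\<close>

lemma sat_lin_support:
  "\<exists>P. finite P \<and> P \<subseteq> lin {} (fv \<phi>) \<times> {S. finite S} \<and>
     (\<forall>e e'. agree P e e' \<longrightarrow> (sat M e \<phi> \<longleftrightarrow> sat M e' \<phi>))"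
proof (induction \<phi>)
  case (Eq s t)
  have "eval_trm M e s = eval_trm M e t \<longleftrightarrow> eval_trm M e (Diff s t) \<in> sub_of M {}" for e
    by (auto simp: K_empty plus_of_eq minus_of_eq inv_solve_right')
  then show ?case
    using lin_eval_trm[of "Diff s t" "{}"]
    by (intro exI[of _ "{(\<lambda>e. eval_trm M e (Diff s t), {})}"]) (auto simp: agree_def)
next
  case (Mem I t)
  then show ?case
    using lin_eval_trm[of t "{}"]
    by (intro exI[of _ "{(\<lambda>e. eval_trm M e t, fset I)}"]) (auto simp: agree_def)
next
  case (Neg \<phi>)
  then show ?case
    by simp
next
  case (Conj \<phi> \<psi>)
  then obtain P Q where
    P: "finite P" "P \<subseteq> lin {} (fv \<phi>) \<times> {S. finite S}"
      "\<forall>e e'. agree P e e' \<longrightarrow> (sat M e \<phi> \<longleftrightarrow> sat M e' \<phi>)" and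
    Q: "finite Q" "Q \<subseteq> lin {} (fv \<psi>) \<times> {S. finite S}"
      "\<forall>e e'. agree Q e e' \<longrightarrow> (sat M e \<psi> \<longleftrightarrow> sat M e' \<psi>)"
    by metis
  have "P \<union> Q \<subseteq> lin {} (fv (Conj \<phi> \<psi>)) \<times> {S. finite S}"
    using P(2) Q(2) lin_mono[of _ "{}" _ "fv (Conj \<phi> \<psi>)"] by fastforce
  moreover have "sat M e (Conj \<phi> \<psi>) \<longleftrightarrow> sat M e' (Conj \<phi> \<psi>)" if "agree (P \<union> Q) e e'" for e e'
  proof -
    have "agree P e e'" "agree Q e e'"
      using that by (auto simp: agree_def)
    then show ?thesis
      using P(3) Q(3) by simp
  qed
  ultimately show ?case
    using P(1) Q(1) by (intro exI[of _ "P \<union> Q"] conjI finite_UnI allI impI)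
next
  case (Exi i \<phi>)
  then obtain P where
    P: "finite P" "P \<subseteq> lin {} (fv \<phi>) \<times> {S. finite S}"
      "\<forall>e e'. agree P e e' \<longrightarrow> (sat M e \<phi> \<longleftrightarrow> sat M e' \<phi>)"
    by metis
  obtain b g where b: "elim {} (fv \<phi>) i b g"
    using ex_elim by blast
  have idx: "P \<subseteq> lin {} (fv \<phi>) \<times> idx"
    using P(2) by auto
  have *: "sat M e' (Exi i \<phi>)" if "sat M e (Exi i \<phi>)" "agree (proj b g P) e e'" for e e'
    using proj_agree[OF b P(1) idx that(2)] that(1) P(3) by (metis sat.simps(5))
  \<comment> \<open>Agreement is symmetric, so the implication just shown yields the
    equivalence.\<close>
  have "agree (proj b g P) e' e" if "agree (proj b g P) e e'" for e e'
    using that by (auto simp: agree_def)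
  then have "\<forall>e e'. agree (proj b g P) e e' \<longrightarrow> (sat M e (Exi i \<phi>) \<longleftrightarrow> sat M e' (Exi i \<phi>))"
    using * by blast
  moreover have "proj b g P \<subseteq> lin {} (fv (Exi i \<phi>)) \<times> {S. finite S}"
    using proj_lin[OF b P(2)] by simp
  ultimately show ?case
    using proj_finite[OF P(1)] by (intro exI[of _ "proj b g P"] conjI)
qed

text \<open>Types contain formulas rather than linear forms, so the support is rewritten with terms
  and predicates of the language.\<close>

lemma sat_trm_support:
  "\<exists>F. finite F \<and> (\<forall>(t, I)\<in>F. fvt t \<subseteq> fv \<phi>) \<and>
     (\<forall>e e'. (\<forall>(t, I)\<in>F. sat M e (Mem I t) \<longleftrightarrow> sat M e' (Mem I t)) \<longrightarrow>
       (sat M e \<phi> \<longleftrightarrow> sat M e' \<phi>))"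
proof -
  obtain P where
    P: "finite P" "P \<subseteq> lin {} (fv \<phi>) \<times> {S. finite S}"
      "\<forall>e e'. agree P e e' \<longrightarrow> (sat M e \<phi> \<longleftrightarrow> sat M e' \<phi>)"
    using sat_lin_support by metis
  have "\<forall>f\<in>lin {} (fv \<phi>). \<exists>t. fvt t \<subseteq> fv \<phi> \<and>
      (\<forall>e S. f e \<in> sub_of M S \<longleftrightarrow> eval_trm M e t \<in> sub_of M S)"
    using lin_is_trm by blast
  from bchoice[OF this] obtain \<tau> where \<tau>: "\<forall>f\<in>lin {} (fv \<phi>). fvt (\<tau> f) \<subseteq> fv \<phi> \<and>
      (\<forall>e S. f e \<in> sub_of M S \<longleftrightarrow> eval_trm M e (\<tau> f) \<in> sub_of M S)"
    by blast
  define F where "F = (\<lambda>(f, S). (\<tau> f, Abs_fset S)) ` P"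
  have mem: "f e \<in> sub_of M S \<longleftrightarrow> sat M e (Mem (Abs_fset S) (\<tau> f))" if "(f, S) \<in> P" for f S e
  proof -
    have "f \<in> lin {} (fv \<phi>)" "finite S"
      using P(2) that by auto
    then have "f e \<in> sub_of M S \<longleftrightarrow> eval_trm M e (\<tau> f) \<in> sub_of M S"
      using \<tau> by blast
    then show ?thesis
      using \<open>finite S\<close> by (simp add: sub_of_def)
  qed
  have "agree P e e'" if "\<forall>(t, I)\<in>F. sat M e (Mem I t) \<longleftrightarrow> sat M e' (Mem I t)" for e e'
    unfolding agree_def
  proof safe
    fix f S
    assume fS: "(f, S) \<in> P"
    then have "(\<tau> f, Abs_fset S) \<in> F"
      unfolding F_def by force
    then have "sat M e (Mem (Abs_fset S) (\<tau> f)) \<longleftrightarrow> sat M e' (Mem (Abs_fset S) (\<tau> f))"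
      using that by blast
    then show "f e \<in> sub_of M S \<Longrightarrow> f e' \<in> sub_of M S" "f e' \<in> sub_of M S \<Longrightarrow> f e \<in> sub_of M S"
      using mem[OF fS] by auto
  qed
  moreover have "\<forall>(t, I)\<in>F. fvt t \<subseteq> fv \<phi>"
    using \<tau> P(2) unfolding F_def by fastforce
  moreover have "finite F"
    using P(1) unfolding F_def by blast
  ultimately show ?thesis
    using P(3) by (intro exI[of _ F]) simp
qed

end

section \<open>Counting types\<close>

instance trm :: countable
  by countable_datatype

instance fm :: (countable) countable
  by countable_datatype

lemma countable_pfms:
  fixes A :: "'a set"
  assumes "countable A"
  shows "countable (pfms A n :: ('i::countable, 'a) pfm set)"
proof (rule countable_subset)
  show "pfms A n \<subseteq> (UNIV :: 'i fm set) \<times> lists A"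
    by (auto simp: pfms_def)
  show "countable ((UNIV :: 'i fm set) \<times> lists A)"
    using assms by (intro countable_SIGMA countable_lists) auto
qed

lemma holds_negp: "holds M xs (negp \<psi>) \<longleftrightarrow> \<not> holds M xs \<psi>"
  by (simp add: holds_def negp_def)

lemma complete_type_realize:
  assumes "p \<in> complete_types M A n" "finite \<Phi>" "\<Phi> \<subseteq> p"
  obtains xs where "length xs = n" "\<And>\<psi>. \<psi> \<in> \<Phi> \<Longrightarrow> holds M xs \<psi>"
  using assms by (force simp: complete_types_def consistent_def)

lemma complete_type_subset: "p \<in> complete_types M A n \<Longrightarrow> p \<subseteq> pfms A n"
  by (simp add: complete_types_def)

lemma negp_in_complete_type:
  assumes "p \<in> complete_types M A n" "\<psi> \<in> pfms A n"
  shows "negp \<psi> \<in> p \<longleftrightarrow> \<psi> \<notin> p"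
proof
  assume *: "negp \<psi> \<in> p"
  show "\<psi> \<notin> p"
  proof
    assume "\<psi> \<in> p"
    then obtain xs where "\<And>\<chi>. \<chi> \<in> {\<psi>, negp \<psi>} \<Longrightarrow> holds M xs \<chi>"
      using complete_type_realize[OF assms(1), of "{\<psi>, negp \<psi>}"] * by auto
    then show False
      using holds_negp by blast
  qed
qed (use assms in \<open>auto simp: complete_types_def\<close>)

text \<open>Equations can be left out: \<open>s = t\<close> says that the difference lies in the
  predicate with empty index.\<close>

definition atomic_pfms :: "'a set \<Rightarrow> nat \<Rightarrow> ('i, 'a) pfm set" where
  "atomic_pfms A n = {\<psi> \<in> pfms A n. \<exists>I t. fst \<psi> = Mem I t}"

context G_model
begin

text \<open>If some formula were in \<open>p\<close> but not in \<open>q\<close>, realizations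
  \<open>xs\<close> of it and \<open>ys\<close> of its negation could be chosen that decide its
  finite support alike, against elimination.\<close>

lemma complete_type_le_if_same_atoms:
  assumes p: "p \<in> complete_types M A n" and q: "q \<in> complete_types M A n"
    and same: "p \<inter> atomic_pfms A n = q \<inter> atomic_pfms A n"
  shows "p \<subseteq> q"
proof (rule ccontr)
  assume "\<not> p \<subseteq> q"
  then obtain \<phi> b where \<phi>: "(\<phi>, b) \<in> p" "(\<phi>, b) \<notin> q"
    by auto
  then have \<phi>_pfms: "(\<phi>, b) \<in> pfms A n"
    using complete_type_subset p by blast
  obtain F where F: "finite F" "\<forall>(t, I)\<in>F. fvt t \<subseteq> fv \<phi>"
    "\<forall>e e'. (\<forall>(t, I)\<in>F. sat M e (Mem I t) \<longleftrightarrow> sat M e' (Mem I t)) \<longrightarrow> (sat M e \<phi> \<longleftrightarrow> sat M e' \<phi>)"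
    using sat_trm_support[of \<phi>] by blast
  define D where "D = (\<lambda>(t, I). (Mem I t, b)) ` F"
  \<comment> \<open>The support atoms, each with the sign that \<open>p\<close> gives it; by
    \<open>same\<close> this is also the sign that \<open>q\<close> gives it.\<close>
  define D' where "D' = D \<inter> p \<union> negp ` (D - p)"
  have "(Mem I t, b) \<in> atomic_pfms A n" if "(t, I) \<in> F" for t I
  proof -
    have "fvt t \<subseteq> fv \<phi>"
      using F(2) that by blast
    then show ?thesis
      using \<phi>_pfms by (auto simp: atomic_pfms_def pfms_def)
  qed
  then have D: "finite D" "D \<subseteq> atomic_pfms A n"
    using F(1) unfolding D_def by auto
  then have D_pfms: "D \<subseteq> pfms A n"
    by (auto simp: atomic_pfms_def)
  have "D' \<subseteq> p"
    using D_pfms negp_in_complete_type[OF p] unfolding D'_def by auto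
  moreover have "\<psi> \<in> p \<longleftrightarrow> \<psi> \<in> q" if "\<psi> \<in> D" for \<psi>
    using same D(2) that by blast
  then have "D' \<subseteq> q"
    using D_pfms negp_in_complete_type[OF q] unfolding D'_def by auto
  moreover have "finite D'"
    using D(1) unfolding D'_def by simp
  moreover have "negp (\<phi>, b) \<in> q"
    using negp_in_complete_type[OF q \<phi>_pfms] \<phi>(2) by blast
  ultimately have "finite (insert (\<phi>, b) D')" "insert (\<phi>, b) D' \<subseteq> p"
    "finite (insert (negp (\<phi>, b)) D')" "insert (negp (\<phi>, b)) D' \<subseteq> q"
    using \<phi>(1) by auto
  then obtain xs ys where
    xs: "\<And>\<psi>. \<psi> \<in> insert (\<phi>, b) D' \<Longrightarrow> holds M xs \<psi>" and
    ys: "\<And>\<psi>. \<psi> \<in> insert (negp (\<phi>, b)) D' \<Longrightarrow> holds M ys \<psi>"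
    using complete_type_realize[OF p] complete_type_realize[OF q] by metis
  have D'_iff: "holds M zs \<psi> \<longleftrightarrow> \<psi> \<in> p" if "\<psi> \<in> D" "\<And>\<psi>. \<psi> \<in> D' \<Longrightarrow> holds M zs \<psi>" for zs \<psi>
  proof (cases "\<psi> \<in> p")
    case False
    then have "negp \<psi> \<in> D'"
      using that(1) by (simp add: D'_def)
    then show ?thesis
      using that(2)[of "negp \<psi>"] False by (simp add: holds_negp)
  qed (use that in \<open>simp add: D'_def\<close>)
  have *: "holds M xs \<psi> \<longleftrightarrow> holds M ys \<psi>" if "\<psi> \<in> D" for \<psi>
    using D'_iff[OF that, of xs] D'_iff[OF that, of ys] xs ys by simp
  have "sat M (\<lambda>i. (xs @ b) ! i) (Mem I t) \<longleftrightarrow> sat M (\<lambda>i. (ys @ b) ! i) (Mem I t)"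
    if "(t, I) \<in> F" for t I
  proof -
    have "(Mem I t, b) \<in> D"
      using that by (force simp: D_def)
    then show ?thesis
      using *[of "(Mem I t, b)"] by (simp add: holds_def)
  qed
  then have "sat M (\<lambda>i. (xs @ b) ! i) \<phi> \<longleftrightarrow> sat M (\<lambda>i. (ys @ b) ! i) \<phi>"
    using F(3) by blast
  then show False
    using xs[of "(\<phi>, b)"] ys[of "negp (\<phi>, b)"] by (simp add: negp_def holds_def)
qed

text \<open>The atoms of \<open>p\<close> are enumerated; the solution sets of the initial
  conjunctions form a descending chain, and an initial segment where it has become stable implies
  all the others.\<close>

lemma complete_type_determined:
  assumes A: "countable A" and p: "p \<in> complete_types M A n"
  shows "\<exists>\<Phi>. finite \<Phi> \<and> \<Phi> \<subseteq> p \<inter> atomic_pfms A n \<and> (\<forall>\<psi>\<in>p \<inter> atomic_pfms A n. \<forall>xs.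
    length xs = n \<longrightarrow> (\<forall>\<chi>\<in>\<Phi>. holds M xs \<chi>) \<longrightarrow> holds M xs \<psi>)"
proof (cases "p \<inter> atomic_pfms A n = {}")
  case False
  define \<psi> where "\<psi> = from_nat_into (p \<inter> atomic_pfms A n)"
  have "p \<inter> atomic_pfms A n \<subseteq> pfms A n"
    by (auto simp: atomic_pfms_def)
  then have "countable (p \<inter> atomic_pfms A n)"
    using countable_pfms[OF A] countable_subset by blast
  then have range: "range \<psi> = p \<inter> atomic_pfms A n"
    using False unfolding \<psi>_def by (intro range_from_nat_into)
  have "\<exists>I t b. \<psi> j = (Mem I t, b)" for j
  proof -
    have "\<psi> j \<in> atomic_pfms A n"
      using range by auto
    then show ?thesis
      by (cases "\<psi> j") (auto simp: atomic_pfms_def)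
  qed
  then obtain I t b where \<psi>: "\<And>j. \<psi> j = (Mem (I j) (t j), b j)"
    by metis
  \<comment> \<open>The parameters become constants of the form, so that atoms with parameter tuples
    of different lengths are conditions in the same \<open>n\<close> variables.\<close>
  define f where "f j e = eval_trm M (\<lambda>i. if i < n then e i else b j ! (i - n)) (t j)" for j e
  have "(\<lambda>e. if i < n then e i else c) \<in> lin UNIV {..<n}" for i c
    by (cases "i < n") (simp_all add: lin_var lin_const)
  then have "f j \<in> lin UNIV {..<n}" for j
    unfolding f_def by (rule lin_subst[OF lin_eval_trm[of _ UNIV] order_refl])
  moreover define P where "P j = (\<lambda>k. (f k, fset (I k))) ` {..<j}" for j
  ultimately have "\<exists>j. \<forall>k\<ge>j. sol (P k) = sol (P j)"
    by (intro sol_chain_stable) auto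
  then obtain j where j: "\<And>k. k \<ge> j \<Longrightarrow> sol (P k) = sol (P j)"
    by blast
  have holds_iff: "holds M xs (\<psi> k) \<longleftrightarrow> f k (\<lambda>i. xs ! i) \<in> sub_of M (fset (I k))"
    if "length xs = n" for xs k
    using that by (simp add: holds_def \<psi> f_def nth_append cong: if_cong)
  have *: "holds M xs (\<psi> k)" if xs: "length xs = n" "\<forall>\<chi>\<in>\<psi> ` {..<j}. holds M xs \<chi>" for k xs
  proof -
    have "(\<lambda>i. xs ! i) \<in> sol (P j)"
      using xs holds_iff[OF xs(1)] by (auto simp: sol_def P_def)
    also have "sol (P j) = sol (P (max j (Suc k)))"
      using j[of "max j (Suc k)"] by simp
    finally show ?thesis
      using holds_iff[OF xs(1)] by (auto simp: sol_def P_def)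
  qed
  show ?thesis
  proof (intro exI[of _ "\<psi> ` {..<j}"] conjI ballI allI impI)
    show "\<psi> ` {..<j} \<subseteq> p \<inter> atomic_pfms A n"
      using range by blast
    fix \<chi> xs
    assume "\<chi> \<in> p \<inter> atomic_pfms A n" and xs: "length xs = n" "\<forall>\<chi>\<in>\<psi> ` {..<j}. holds M xs \<chi>"
    then obtain k where "\<chi> = \<psi> k"
      using range by blast
    then show "holds M xs \<chi>"
      using *[OF xs] by simp
  qed simp
qed auto

text \<open>The choice of a determining finite set is injective on types: a type omitting an atom
  implied by its own determining set would be inconsistent. There are only countably many finite
  sets of formulas over \<open>A\<close>.\<close>

lemma countable_complete_types:
  assumes A: "countable A"
  shows "countable (complete_types M A n)"
proof -
  have "\<forall>p\<in>complete_types M A n. \<exists>\<Phi>. finite \<Phi> \<and> \<Phi> \<subseteq> p \<inter> atomic_pfms A n \<and>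
    (\<forall>\<psi>\<in>p \<inter> atomic_pfms A n. \<forall>xs. length xs = n \<longrightarrow> (\<forall>\<chi>\<in>\<Phi>. holds M xs \<chi>) \<longrightarrow> holds M xs \<psi>)"
    using complete_type_determined[OF A] by blast
  from bchoice[OF this] obtain \<Phi> where \<Phi>: "\<forall>p\<in>complete_types M A n. finite (\<Phi> p) \<and>
    \<Phi> p \<subseteq> p \<inter> atomic_pfms A n \<and> (\<forall>\<psi>\<in>p \<inter> atomic_pfms A n. \<forall>xs. length xs = n \<longrightarrow>
      (\<forall>\<chi>\<in>\<Phi> p. holds M xs \<chi>) \<longrightarrow> holds M xs \<psi>)"
    by blast
  have le: "p \<inter> atomic_pfms A n \<subseteq> q \<inter> atomic_pfms A n"
    if p: "p \<in> complete_types M A n" and q: "q \<in> complete_types M A n" and eq: "\<Phi> p = \<Phi> q" for p q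
  proof
    fix \<psi>
    assume \<psi>: "\<psi> \<in> p \<inter> atomic_pfms A n"
    have "\<psi> \<in> q"
    proof (rule ccontr)
      assume "\<psi> \<notin> q"
      then have "negp \<psi> \<in> q"
        using negp_in_complete_type[OF q] \<psi> by (auto simp: atomic_pfms_def)
      moreover have "finite (\<Phi> q)" "\<Phi> q \<subseteq> q"
        using bspec[OF \<Phi> q] by auto
      ultimately obtain xs where xs: "length xs = n" "\<And>\<chi>. \<chi> \<in> insert (negp \<psi>) (\<Phi> q) \<Longrightarrow> holds M xs \<chi>"
        using complete_type_realize[OF q, of "insert (negp \<psi>) (\<Phi> q)"] by auto
      then have "holds M xs \<psi>"
        using bspec[OF \<Phi> p] \<psi> eq by auto
      then show False
        using xs(2)[of "negp \<psi>"] by (simp add: holds_negp)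
    qed
    then show "\<psi> \<in> q \<inter> atomic_pfms A n"
      using \<psi> by blast
  qed
  have inj: "inj_on \<Phi> (complete_types M A n)"
  proof (rule inj_onI)
    fix p q
    assume pq: "p \<in> complete_types M A n" "q \<in> complete_types M A n" "\<Phi> p = \<Phi> q"
    have "p \<inter> atomic_pfms A n = q \<inter> atomic_pfms A n"
      using le[OF pq] le[OF pq(2,1) pq(3)[symmetric]] by (rule equalityI)
    then show "p = q"
      using complete_type_le_if_same_atoms[OF pq(1,2)]
        complete_type_le_if_same_atoms[OF pq(2,1) sym] by (intro equalityI) simp_all
  qed
  have "\<Phi> ` complete_types M A n \<subseteq> {X. finite X \<and> X \<subseteq> pfms A n}"
  proof safe
    fix p \<psi>
    assume p: "p \<in> complete_types M A n"
    show "finite (\<Phi> p)"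
      using bspec[OF \<Phi> p] by blast
    show "\<psi> \<in> \<Phi> p \<Longrightarrow> \<psi> \<in> pfms A n"
      using bspec[OF \<Phi> p] by (auto simp: atomic_pfms_def)
  qed
  then have "countable (\<Phi> ` complete_types M A n)"
    by (rule countable_subset) (rule countable_Collect_finite_subset[OF countable_pfms[OF A]])
  from this inj show ?thesis
    by (rule countable_image_inj_on)
qed

end

section \<open>Morley rank and dp-rank\<close>

context subgroup_family
begin

section \<open>Generic behaviour of definable sets in a class\<close>

definition covers :: "('a \<times> nat set) set \<Rightarrow> 'a set \<Rightarrow> bool" where
  "covers P X \<longleftrightarrow> (\<forall>x\<in>X. \<exists>(a, S)\<in>P. cg S a x)"

text \<open>A definable set is null in the class of \<open>a\<close> iff it meets it in a set of smaller Morley rank.\<close>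

definition null_in :: "nat set \<Rightarrow> 'a \<Rightarrow> 'a set \<Rightarrow> bool" where
  "null_in S a X \<longleftrightarrow>
    (\<exists>P. finite P \<and> (\<forall>(b, T)\<in>P. T \<in> idx \<and> T \<subset> S) \<and> covers P {x \<in> X. cg S a x})"

lemma covers_mono: "covers P X \<Longrightarrow> Y \<subseteq> X \<Longrightarrow> covers P Y"
  by (auto simp: covers_def)

lemma null_in_Un:
  assumes "null_in S a X" "null_in S a Y"
  shows "null_in S a (X \<union> Y)"
proof -
  obtain P Q where
    P: "finite P" "\<forall>(b, T)\<in>P. T \<in> idx \<and> T \<subset> S" "covers P {x \<in> X. cg S a x}" and
    Q: "finite Q" "\<forall>(b, T)\<in>Q. T \<in> idx \<and> T \<subset> S" "covers Q {x \<in> Y. cg S a x}"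
    using assms unfolding null_in_def by blast
  have "covers (P \<union> Q) {x \<in> X \<union> Y. cg S a x}"
    using P(3) Q(3) unfolding covers_def by blast
  moreover have "\<forall>(b, T)\<in>P \<union> Q. T \<in> idx \<and> T \<subset> S"
    using P(2) Q(2) by blast
  ultimately show ?thesis
    using P(1) Q(1) unfolding null_in_def by (intro exI[of _ "P \<union> Q"]) simp
qed

text \<open>A restatement of \<open>class_not_covered\<close>; it is what makes the null sets a
  proper ideal in each class.\<close>

lemma not_null_in_UNIV:
  assumes "S \<in> idx"
  shows "\<not> null_in S a UNIV"
proof
  assume "null_in S a UNIV"
  then obtain P where P: "finite P" "\<forall>(b, T)\<in>P. T \<in> idx \<and> T \<subset> S" "covers P {x. cg S a x}"
    unfolding null_in_def by auto
  have "\<exists>y. cg S a y \<and> (\<forall>(b, T)\<in>P. \<not> cg T b y)"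
    by (rule class_not_covered[OF assms P(1)]) (use P(2) in auto)
  then obtain y where "cg S a y" "\<forall>(b, T)\<in>P. \<not> cg T b y"
    by blast
  then show False
    using P(3) unfolding covers_def by blast
qed

lemma lin_null_dichotomy:
  assumes S: "S \<in> idx" and P: "finite P" "P \<subseteq> lin C V \<times> idx"
    and X: "\<And>x y. agree P (e(i := x)) (e(i := y)) \<Longrightarrow> x \<in> X \<longleftrightarrow> y \<in> X"
  shows "null_in S a X \<or> null_in S a (- X)"
proof -
  obtain b g where b: "elim C V i b g"
    using ex_elim by blast
  define c where "c R r = (SOME x. cg S a x \<and> cg R r x)" for R r
  define Q where "Q = (\<lambda>(f, R). (c R (g f e), S \<inter> R)) ` {(f, R) \<in> P. \<not> S \<subseteq> R}"
  have "finite {(f, R) \<in> P. \<not> S \<subseteq> R}"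
    by (rule finite_subset[OF _ P(1)]) auto
  then have Q_finite: "finite Q"
    unfolding Q_def by blast
  have Q_idx: "\<forall>(b, T)\<in>Q. T \<in> idx \<and> T \<subset> S"
    using S P(2) unfolding Q_def by auto
  \<comment> \<open>The generic part of the class, on which every condition of \<open>P\<close> is
    constant: for \<open>S \<subseteq> R\<close> because the class lies inside one class modulo
    \<open>R\<close>, otherwise because the points satisfying a congruence on the variable have been
    removed.\<close>
  define Y where "Y = {x. cg S a x \<and> \<not> (\<exists>(b, T)\<in>Q. cg T b x)}"
  have *: "f (e(i := x)) \<in> K R \<longleftrightarrow> f (e(i := y)) \<in> K R"
    if xy: "x \<in> Y" "y \<in> Y" and fR: "(f, R) \<in> P" for x y f R
  proof -
    have upd: "f (e(i := x)) \<in> K R \<longleftrightarrow> (if b f then cg R x (g f e) else g f e \<in> K R)" for x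
      using fR P(2) by (intro elim_upd[OF b]) auto
    have R: "R \<in> idx"
      using fR P(2) by auto
    have imp: "cg R x (g f e) \<Longrightarrow> cg R y (g f e)" if xy: "x \<in> Y" "y \<in> Y" for x y
    proof (cases "S \<subseteq> R")
      case True
      assume r: "cg R x (g f e)"
      have "cg S y x"
        using xy cg_sym cg_trans unfolding Y_def by blast
      then show ?thesis
        using cg_mono[OF S R True] r cg_trans by blast
    next
      case False
      assume "cg R x (g f e)"
      then have x: "cg S a x \<and> cg R (g f e) x"
        using xy cg_sym unfolding Y_def by blast
      then have "cg S a (c R (g f e)) \<and> cg R (g f e) (c R (g f e))"
        unfolding c_def by (rule someI)
      then have "cg (S \<inter> R) (c R (g f e)) x"
        using x cg_sym cg_trans by (subst cg_Int[OF S R]) blast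
      moreover have "(c R (g f e), S \<inter> R) \<in> Q"
        unfolding Q_def using fR False by force
      ultimately show ?thesis
        using xy unfolding Y_def by blast
    qed
    show ?thesis
      unfolding upd using imp[OF xy] imp[OF xy(2,1)] by metis
  qed
  have "x \<in> X \<longleftrightarrow> y \<in> X" if "x \<in> Y" "y \<in> Y" for x y
    using *[OF that] by (intro X) (auto simp: agree_def)
  then have "Y \<subseteq> X \<or> Y \<subseteq> - X"
    by blast
  moreover have "null_in S a Z" if "Y \<subseteq> - Z" for Z
  proof -
    have "covers Q {x \<in> Z. cg S a x}"
      using that unfolding covers_def Y_def by blast
    then show ?thesis
      using Q_finite Q_idx unfolding null_in_def by blast
  qed
  ultimately show ?thesis
    by auto
qed

end

lemma morley_ge_mono:
  fixes M :: "('i, 'a) lstructure"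
  shows "morley_ge M \<alpha> \<psi> \<Longrightarrow> solutions M 1 \<psi> \<subseteq> solutions M 1 \<psi>' \<Longrightarrow> morley_ge M \<alpha> \<psi>'"
proof (induction \<alpha> arbitrary: \<psi> \<psi>')
  case (OSucc \<alpha>)
  from OSucc.prems(1)[unfolded morley_ge.simps] obtain \<chi> :: "nat \<Rightarrow> ('i, 'a) pfm" where
    \<chi>: "\<forall>i. \<chi> i \<in> pfms UNIV 1 \<and> solutions M 1 (\<chi> i) \<subseteq> solutions M 1 \<psi> \<and> morley_ge M \<alpha> (\<chi> i)" and
    disj: "\<forall>i j. i \<noteq> j \<longrightarrow> solutions M 1 (\<chi> i) \<inter> solutions M 1 (\<chi> j) = {}"
    by blast
  have "\<forall>i. \<chi> i \<in> pfms UNIV 1 \<and> solutions M 1 (\<chi> i) \<subseteq> solutions M 1 \<psi>' \<and> morley_ge M \<alpha> (\<chi> i)"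
    using \<chi> OSucc.prems(2) by (meson order_trans)
  then show ?case
    unfolding morley_ge.simps using disj by (intro exI conjI)
next
  case (OSup f)
  show ?case
    unfolding morley_ge.simps
  proof
    fix n
    have "morley_ge M (f n) \<psi>"
      using OSup.prems(1) by simp
    then show "morley_ge M (f n) \<psi>'"
      using OSup.IH OSup.prems(2) by blast
  qed
qed auto

lemma morley_ge_omega:
  "morley_ge M cord_omega \<psi> \<longleftrightarrow> (\<forall>n. morley_ge M ((OSucc ^^ n) OZero) \<psi>)"
  by (simp add: cord_omega_def)

section \<open>Morley rank of classes and of the whole group\<close>

definition coset_fm :: "nat set \<Rightarrow> nat fset fm" where
  "coset_fm S = Mem (Abs_fset S) (Diff (Var 0) (Var 1))"

context G_model
begin

definition sols :: "(nat fset, 'a) pfm \<Rightarrow> 'a set" where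
  "sols \<psi> = {x. holds M [x] \<psi>}"

lemma solutions_eq: "solutions M 1 \<psi> = (\<lambda>x. [x]) ` sols \<psi>"
  by (auto simp: solutions_def sols_def length_Suc_conv)

lemma solutions_subset_iff: "solutions M 1 \<psi> \<subseteq> solutions M 1 \<psi>' \<longleftrightarrow> sols \<psi> \<subseteq> sols \<psi>'"
  unfolding solutions_eq by auto

lemma morley_ge_OZero: "morley_ge M OZero \<psi> \<longleftrightarrow> sols \<psi> \<noteq> {}"
  unfolding morley_ge.simps solutions_eq by auto

lemma morley_ge_OSucc:
  "morley_ge M (OSucc \<alpha>) \<psi> \<longleftrightarrow> (\<exists>\<chi> :: nat \<Rightarrow> (nat fset, 'a) pfm.
     (\<forall>i. \<chi> i \<in> pfms UNIV 1 \<and> sols (\<chi> i) \<subseteq> sols \<psi> \<and> morley_ge M \<alpha> (\<chi> i)) \<and>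
     (\<forall>i j. i \<noteq> j \<longrightarrow> sols (\<chi> i) \<inter> sols (\<chi> j) = {}))"
proof -
  have "solutions M 1 \<chi> \<inter> solutions M 1 \<chi>' = {} \<longleftrightarrow> sols \<chi> \<inter> sols \<chi>' = {}" for \<chi> \<chi>'
    unfolding solutions_eq by auto
  then show ?thesis
    by (simp only: morley_ge.simps solutions_subset_iff)
qed

lemma sols_null_dichotomy:
  assumes "S \<in> idx"
  shows "null_in S a (sols \<psi>) \<or> null_in S a (- sols \<psi>)"
proof -
  obtain \<phi> b where \<psi>: "\<psi> = (\<phi>, b)"
    by fastforce
  obtain P where P: "finite P" "P \<subseteq> lin {} (fv \<phi>) \<times> {S. finite S}"
    "\<forall>e e'. agree P e e' \<longrightarrow> (sat M e \<phi> \<longleftrightarrow> sat M e' \<phi>)"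
    using sat_lin_support[of \<phi>] by blast
  \<comment> \<open>Parameters start at \<open>Var 1\<close>, whence the shift; the value at
    \<open>0\<close> is always overwritten by the object variable.\<close>
  define e where "e i = b ! (i - 1)" for i
  have env: "(\<lambda>i. ([x] @ b) ! i) = e(0 := x)" for x
    by (auto simp: e_def nth_Cons')
  have "x \<in> sols \<psi> \<longleftrightarrow> sat M (e(0 := x)) \<phi>" for x
    unfolding sols_def holds_def \<psi> mem_Collect_eq fst_conv snd_conv env ..
  then have "agree P (e(0 := x)) (e(0 := y)) \<Longrightarrow> x \<in> sols \<psi> \<longleftrightarrow> y \<in> sols \<psi>" for x y
    using P(3) by blast
  moreover have "P \<subseteq> lin {} (fv \<phi>) \<times> idx"
    using P(2) by auto
  ultimately show ?thesis
    by (intro lin_null_dichotomy[OF assms P(1)])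
qed

text \<open>Each class has Morley degree one: by the dichotomy the complements of two non-null
  definable sets are null, and they cannot cover the class.\<close>

lemma not_null_in_imp_meet:
  assumes "S \<in> idx" "\<not> null_in S a (sols \<psi>)" "\<not> null_in S a (sols \<chi>)"
  shows "sols \<psi> \<inter> sols \<chi> \<noteq> {}"
proof
  assume "sols \<psi> \<inter> sols \<chi> = {}"
  then have "- sols \<psi> \<union> - sols \<chi> = UNIV"
    by auto
  moreover have "null_in S a (- sols \<psi> \<union> - sols \<chi>)"
    using sols_null_dichotomy[OF assms(1)] assms(2,3) by (blast intro: null_in_Un)
  ultimately show False
    using not_null_in_UNIV[OF assms(1)] by simp
qed

text \<open>A covering certificate for Morley rank below \<open>n\<close>; with \<open>n = 0\<close>
  it admits only the empty set.\<close>

definition small :: "nat \<Rightarrow> 'a set \<Rightarrow> bool" where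
  "small n X \<longleftrightarrow> (\<exists>P. finite P \<and> (\<forall>(a, S)\<in>P. finite S \<and> card S < n) \<and> covers P X)"

text \<open>If \<open>X\<close> were null in each class of the cover, the covers of the pieces would
  together be a finite cover by classes with strictly smaller index sets.\<close>

lemma not_null_in_if_not_small:
  assumes P: "finite P" "\<forall>(a, S)\<in>P. finite S \<and> card S \<le> n" "covers P X" and X: "\<not> small n X"
  shows "\<exists>q\<in>P. \<not> null_in (snd q) (fst q) X"
proof (rule ccontr)
  assume *: "\<not> (\<exists>q\<in>P. \<not> null_in (snd q) (fst q) X)"
  have "\<forall>q\<in>P. \<exists>Q. finite Q \<and> (\<forall>(b, T)\<in>Q. T \<in> idx \<and> T \<subset> snd q) \<and>
      covers Q {x \<in> X. cg (snd q) (fst q) x}"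
    using * unfolding null_in_def by blast
  from bchoice[OF this] obtain Q where Q: "\<forall>q\<in>P. finite (Q q) \<and>
      (\<forall>(b, T)\<in>Q q. T \<in> idx \<and> T \<subset> snd q) \<and> covers (Q q) {x \<in> X. cg (snd q) (fst q) x}"
    by blast
  have "small n X"
    unfolding small_def
  proof (intro exI[of _ "\<Union> (Q ` P)"] conjI ballI)
    show "finite (\<Union> (Q ` P))"
      using P(1) Q by blast
    show "case r of (b, T) \<Rightarrow> finite T \<and> card T < n" if "r \<in> \<Union> (Q ` P)" for r
    proof -
      obtain b T where r: "r = (b, T)"
        by fastforce
      obtain q where q: "q \<in> P" "r \<in> Q q"
        using \<open>r \<in> \<Union> (Q ` P)\<close> by blast
      have "T \<subset> snd q"
        using bspec[OF Q q(1)] q(2) r by auto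
      moreover have "finite (snd q)" "card (snd q) \<le> n"
        using P(2) q(1) by auto
      ultimately show ?thesis
        using r psubset_card_mono[of "snd q" T] finite_subset[of T "snd q"] by auto
    qed
    show "covers (\<Union> (Q ` P)) X"
      unfolding covers_def
    proof
      fix x
      assume x: "x \<in> X"
      then obtain q where q: "q \<in> P" "cg (snd q) (fst q) x"
        using P(3) unfolding covers_def by fastforce
      then have "\<exists>(b, T)\<in>Q q. cg T b x"
        using x bspec[OF Q q(1)] unfolding covers_def by blast
      then show "\<exists>(b, T)\<in>\<Union> (Q ` P). cg T b x"
        using q(1) by blast
    qed
  qed
  with X show False ..
qed

text \<open>Rank at least \<open>Suc n\<close> gives infinitely many disjoint sets of rank at least
  \<open>n\<close>. By induction none is \<open>small n\<close>, so each is non-null in one of the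
  finitely many covering classes; two of them share such a class and hence meet.\<close>

lemma morley_less_if_small:
  "small n (sols \<psi>) \<Longrightarrow> \<not> morley_ge M ((OSucc ^^ n) OZero) \<psi>"
proof (induction n arbitrary: \<psi>)
  case 0
  then show ?case
    by (auto simp: small_def covers_def morley_ge_OZero simp del: morley_ge.simps)
next
  case (Suc n)
  from Suc.prems obtain P where
    P: "finite P" "\<forall>(a, S)\<in>P. finite S \<and> card S < Suc n" "covers P (sols \<psi>)"
    unfolding small_def by blast
  show ?case
  proof
    assume "morley_ge M ((OSucc ^^ Suc n) OZero) \<psi>"
    then obtain \<chi> :: "nat \<Rightarrow> (nat fset, 'a) pfm" where \<chi>:
      "\<And>i. sols (\<chi> i) \<subseteq> sols \<psi>" "\<And>i. morley_ge M ((OSucc ^^ n) OZero) (\<chi> i)"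
      "\<And>i j. i \<noteq> j \<Longrightarrow> sols (\<chi> i) \<inter> sols (\<chi> j) = {}"
      unfolding funpow.simps o_apply morley_ge_OSucc by blast
    have "\<exists>q\<in>P. \<not> null_in (snd q) (fst q) (sols (\<chi> i))" for i
    proof -
      have "\<not> small n (sols (\<chi> i))"
        using Suc.IH \<chi>(2) by blast
      moreover have "covers P (sols (\<chi> i))"
        using P(3) \<chi>(1) by (rule covers_mono)
      moreover have "\<forall>(a, S)\<in>P. finite S \<and> card S \<le> n"
        using P(2) by auto
      ultimately show ?thesis
        by (intro not_null_in_if_not_small[OF P(1)])
    qed
    then obtain q where q: "\<And>i. q i \<in> P" "\<And>i. \<not> null_in (snd (q i)) (fst (q i)) (sols (\<chi> i))"
      by metis
    have "\<not> inj q"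
      using P(1) q(1) by (metis finite_subset image_subsetI infinite_UNIV_nat finite_imageD)
    then obtain i j where ij: "i \<noteq> j" "q i = q j"
      by (auto simp: inj_def)
    have "finite (snd (q i))"
      using P(2) q(1)[of i] by auto
    then show False
      using not_null_in_imp_meet[of "snd (q i)" "fst (q i)" "\<chi> i" "\<chi> j"] q(2)[of i] q(2)[of j] ij \<chi>(3)
      by auto
  qed
qed

text \<open>The whole group is the single class modulo \<open>K UNIV\<close>. A set null in it is
  \<open>small n\<close> for some \<open>n\<close>, so sets of rank at least omega are non-null
  there, and already two of them cannot be disjoint.\<close>

lemma not_morley_ge_Suc_omega: "\<not> morley_ge M (OSucc cord_omega) \<psi>"
proof
  assume "morley_ge M (OSucc cord_omega) \<psi>"
  then obtain \<chi> :: "nat \<Rightarrow> (nat fset, 'a) pfm" where \<chi>: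
    "\<And>i. morley_ge M cord_omega (\<chi> i)" "\<And>i j. i \<noteq> j \<Longrightarrow> sols (\<chi> i) \<inter> sols (\<chi> j) = {}"
    unfolding morley_ge_OSucc by blast
  have "\<not> null_in UNIV a (sols (\<chi> i))" for i a
  proof
    assume "null_in UNIV a (sols (\<chi> i))"
    then obtain P where P: "finite P" "\<forall>(b, T)\<in>P. T \<in> idx \<and> T \<subset> UNIV" "covers P (sols (\<chi> i))"
      unfolding null_in_def by auto
    \<comment> \<open>A strict bound on the sizes of the finitely many index sets; for empty
      \<open>P\<close> the value is arbitrary and nothing has to be bounded.\<close>
    define n where "n = Suc (Max (card ` snd ` P))"
    have "finite T \<and> card T < n" if "(b, T) \<in> P" for b T
    proof -
      have "card T \<in> card ` snd ` P"
        using that by force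
      then have "card T \<le> Max (card ` snd ` P)"
        using P(1) by (intro Max_ge) auto
      moreover have "T \<in> idx" "T \<noteq> UNIV"
        using P(2) that by auto
      ultimately show ?thesis
        by (simp add: n_def idx_def)
    qed
    then have "small n (sols (\<chi> i))"
      using P(1,3) unfolding small_def by (intro exI[of _ P]) auto
    then show False
      using morley_less_if_small \<chi>(1) unfolding morley_ge_omega by blast
  qed
  then show False
    using not_null_in_imp_meet[OF idx_UNIV, of undefined "\<chi> 0" "\<chi> 1"] \<chi>(2)[of 0 1] by simp
qed

lemma fv_coset_fm: "fv (coset_fm S) = {0, 1}"
  by (simp add: coset_fm_def insert_commute)

lemma holds_coset_fm: "finite S \<Longrightarrow> holds M [x] (coset_fm S, [c]) \<longleftrightarrow> cg S x c"
  by (simp add: holds_def coset_fm_def cg_def sub_of_def plus_of_eq minus_of_eq)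

lemma sols_coset_fm: "finite S \<Longrightarrow> sols (coset_fm S, [c]) = {x. cg S x c}"
  by (simp add: sols_def holds_coset_fm)

lemma coset_fm_in_pfms: "(coset_fm S, [c]) \<in> pfms UNIV 1"
  by (simp add: pfms_def fv_coset_fm)

text \<open>A class modulo \<open>insert i S\<close> contains infinitely many disjoint classes
  modulo \<open>S\<close>, so every added index raises the rank by one.\<close>

lemma morley_ge_coset_fm:
  "finite S \<Longrightarrow> morley_ge M ((OSucc ^^ card S) OZero) (coset_fm S, [c])"
proof (induction S arbitrary: c rule: finite_induct)
  case empty
  then show ?case
    by (auto simp: morley_ge_OZero sols_coset_fm simp del: morley_ge.simps intro: exI[of _ c])
next
  case (insert i S)
  obtain a :: "nat \<Rightarrow> 'a" where a: "\<And>m. cg (insert i S) c (a m)" "\<And>m n. m \<noteq> n \<Longrightarrow> \<not> cg S (a m) (a n)"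
    using infinite_classes[of "insert i S" S c] insert.hyps by auto
  have "cg (insert i S) x c" if "cg S x (a m)" for x m
    using cg_mono[of S "insert i S" x "a m"] insert.hyps(1) that a(1)[of m] cg_sym cg_trans
    by (meson finite_insert idx_finite subset_insertI)
  then have "sols (coset_fm S, [a m]) \<subseteq> sols (coset_fm (insert i S), [c])" for m
    using insert.hyps(1) by (auto simp: sols_coset_fm)
  moreover have "sols (coset_fm S, [a m]) \<inter> sols (coset_fm S, [a n]) = {}" if "m \<noteq> n" for m n
  proof -
    have False if "cg S x (a m)" "cg S x (a n)" for x
      using that a(2)[OF \<open>m \<noteq> n\<close>] cg_sym cg_trans by blast
    then show ?thesis
      using insert.hyps(1) by (auto simp: sols_coset_fm)
  qed
  ultimately have "morley_ge M (OSucc ((OSucc ^^ card S) OZero)) (coset_fm (insert i S), [c])"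
    unfolding morley_ge_OSucc using insert.IH coset_fm_in_pfms
    by (intro exI[of _ "\<lambda>m. (coset_fm S, [a m])"] conjI allI impI)
  then show ?case
    using insert.hyps by (simp del: morley_ge.simps)
qed

section \<open>Rank omega and inp-patterns of every finite depth\<close>

lemma holds_trivial_pfm: "holds M xs trivial_pfm"
  by (simp add: holds_def trivial_pfm_def)

lemma morley_rank_trivial_pfm: "has_morley_rank M trivial_pfm cord_omega"
  unfolding has_morley_rank_def
proof
  show "morley_ge M cord_omega trivial_pfm"
    unfolding morley_ge_omega
  proof
    fix n
    have "morley_ge M ((OSucc ^^ n) OZero) (coset_fm {..<n}, [undefined])"
      using morley_ge_coset_fm[of "{..<n}"] by simp
    then show "morley_ge M ((OSucc ^^ n) OZero) trivial_pfm"
      by (rule morley_ge_mono) (auto simp: solutions_def holds_trivial_pfm)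
  qed
qed (rule not_morley_ge_Suc_omega)

text \<open>For different rows the two index sets have union \<open>{..<d}\<close>, and all
  parameters lie in one class modulo that set, so \<open>chinese_remainder\<close> realizes every
  path. Rows are 2-inconsistent because their classes are distinct.\<close>

lemma inp_pattern_cosets:
  "inp_pattern M 1 {trivial_pfm} {..<d} (\<lambda>\<alpha>. coset_fm ({..<d} - {\<alpha>})) (\<lambda>_. 2)"
proof -
  \<comment> \<open>\<open>undefined\<close> only fixes a common base class for all rows; any
    element would serve.\<close>
  have "\<exists>a :: nat \<Rightarrow> 'a. (\<forall>m. cg {..<d} undefined (a m)) \<and>
      (\<forall>m n. m \<noteq> n \<longrightarrow> \<not> cg ({..<d} - {\<alpha>}) (a m) (a n))" if "\<alpha> < d" for \<alpha>
  proof -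
    have "\<not> {..<d} \<subseteq> {..<d} - {\<alpha>}"
      using that by auto
    then show ?thesis
      using infinite_classes[of "{..<d}" "{..<d} - {\<alpha>}" undefined] by (metis finite_Diff finite_lessThan idx_finite)
  qed
  then obtain a :: "nat \<Rightarrow> nat \<Rightarrow> 'a" where
    a: "\<And>\<alpha> m. \<alpha> < d \<Longrightarrow> cg {..<d} undefined (a \<alpha> m)"
      "\<And>\<alpha> m n. \<alpha> < d \<Longrightarrow> m \<noteq> n \<Longrightarrow> \<not> cg ({..<d} - {\<alpha>}) (a \<alpha> m) (a \<alpha> n)"
    by metis
  show ?thesis
    unfolding inp_pattern_def
  proof (intro exI[of _ "\<lambda>_. 1"] exI[of _ "\<lambda>\<alpha> m. [a \<alpha> m]"] conjI ballI allI impI)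
    show "fv (coset_fm ({..<d} - {\<alpha>})) \<subseteq> {..<1 + 1}" for \<alpha>
      by (auto simp: fv_coset_fm)
    show "\<not> consistent M 1 ((\<lambda>i. (coset_fm ({..<d} - {\<alpha>}), [a \<alpha> i])) ` I)"
      if \<alpha>: "\<alpha> \<in> {..<d}" and I: "finite I \<and> card I = 2" for \<alpha> I
    proof
      let ?\<Phi> = "(\<lambda>i. (coset_fm ({..<d} - {\<alpha>}), [a \<alpha> i])) ` I"
      assume "consistent M 1 ?\<Phi>"
      moreover have "finite ?\<Phi>"
        using I by simp
      ultimately have "\<exists>xs. length xs = 1 \<and> (\<forall>\<psi>\<in>?\<Phi>. holds M xs \<psi>)"
        unfolding consistent_def by blast
      then obtain xs where xs: "length xs = 1"
        "\<And>i. i \<in> I \<Longrightarrow> holds M xs (coset_fm ({..<d} - {\<alpha>}), [a \<alpha> i])"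
        by auto
      then obtain x where "xs = [x]"
        by (auto simp: length_Suc_conv)
      then have x: "cg ({..<d} - {\<alpha>}) x (a \<alpha> i)" if "i \<in> I" for i
        using xs(2)[OF that] by (simp add: holds_coset_fm)
      obtain i j where ij: "i \<in> I" "j \<in> I" "i \<noteq> j"
        using I by (metis card_2_iff insertI1 insertI2)
      have "cg ({..<d} - {\<alpha>}) (a \<alpha> i) (a \<alpha> j)"
        using cg_trans[OF cg_sym[OF x[OF ij(1)]] x[OF ij(2)]] .
      then show False
        using a(2)[of \<alpha> i j] \<alpha> ij(3) by simp
    qed
    fix \<eta> :: "nat \<Rightarrow> nat"
    have "\<exists>y. \<forall>(r, S)\<in>(\<lambda>\<alpha>. (a \<alpha> (\<eta> \<alpha>), {..<d} - {\<alpha>})) ` {..<d}. cg S y r"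
    proof (rule chinese_remainder)
      fix r S r' S'
      assume "(r, S) \<in> (\<lambda>\<alpha>. (a \<alpha> (\<eta> \<alpha>), {..<d} - {\<alpha>})) ` {..<d}"
        "(r', S') \<in> (\<lambda>\<alpha>. (a \<alpha> (\<eta> \<alpha>), {..<d} - {\<alpha>})) ` {..<d}"
      then obtain \<alpha> \<beta> where *: "\<alpha> < d" "r = a \<alpha> (\<eta> \<alpha>)" "S = {..<d} - {\<alpha>}"
        "\<beta> < d" "r' = a \<beta> (\<eta> \<beta>)" "S' = {..<d} - {\<beta>}"
        by auto
      show "cg (S \<union> S') r r'"
      proof (cases "\<alpha> = \<beta>")
        case False
        then have "S \<union> S' = {..<d}"
          using * by auto
        then show ?thesis
          using cg_trans[OF cg_sym[OF a(1)[OF *(1)]] a(1)[OF *(4)]] *(2,5) by simp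
      qed (use * in simp)
    qed auto
    then obtain y where y: "\<And>\<alpha>. \<alpha> < d \<Longrightarrow> cg ({..<d} - {\<alpha>}) y (a \<alpha> (\<eta> \<alpha>))"
      by auto
    then have y: "holds M [y] \<psi>"
      if "\<psi> \<in> {trivial_pfm} \<union> (\<lambda>\<alpha>. (coset_fm ({..<d} - {\<alpha>}), [a \<alpha> (\<eta> \<alpha>)])) ` {..<d}" for \<psi>
      using that by (auto simp: holds_trivial_pfm holds_coset_fm)
    show "consistent M 1 ({trivial_pfm} \<union> (\<lambda>\<alpha>. (coset_fm ({..<d} - {\<alpha>}), [a \<alpha> (\<eta> \<alpha>)])) ` {..<d})"
      unfolding consistent_def by (intro allI impI exI[of _ "[y]"] conjI ballI y) (simp, blast)
  qed simp
qed

lemma enat_le_dp_rank: "enat d \<le> dp_rank M 1 {trivial_pfm}"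
  unfolding dp_rank_def
proof (rule Sup_upper, rule CollectI, intro exI)
  show "inp_pattern M 1 {trivial_pfm} {\<alpha>. enat \<alpha> < enat d}
      (\<lambda>\<alpha>. coset_fm ({..<d} - {\<alpha>})) (\<lambda>_. 2)"
    using inp_pattern_cosets[of d] by (simp add: lessThan_def)
qed

end

theorem proposition7p1:
  shows "omega_stable TYPE('m) G_struct \<and>
    (\<forall>U :: (nat fset, 'u) lstructure. elem_equiv U G_struct \<and> omega_saturated U \<longrightarrow>
       has_morley_rank U trivial_pfm cord_omega \<and>
       \<not> (\<exists>d::nat. dp_rank U 1 {trivial_pfm} = enat d))"
proof (intro conjI allI impI)
  show "omega_stable TYPE('m) G_struct"
    unfolding omega_stable_def
    by (blast intro: G_model.countable_complete_types G_model.intro)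
next
  fix U :: "(nat fset, 'u) lstructure"
  assume "elem_equiv U G_struct \<and> omega_saturated U"
  then interpret G_model U
    by unfold_locales simp
  show "has_morley_rank U trivial_pfm cord_omega"
    by (rule morley_rank_trivial_pfm)
  show "\<not> (\<exists>d::nat. dp_rank U 1 {trivial_pfm} = enat d)"
  proof
    assume "\<exists>d::nat. dp_rank U 1 {trivial_pfm} = enat d"
    then obtain d where "dp_rank U 1 {trivial_pfm} = enat d" ..
    then show False
      using enat_le_dp_rank[of "Suc d"] by simp
  qed
qed

end
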